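(* Let $\omega\in\mathbb{R}\setminus\mathbb{Q}$, $\lambda=e^{2\pi i\omega}$, and let $(q_k)_{k\ge0}$ be the denominators of the convergents of $\omega$. Let $(M_n)_{n\ge1}$ be a sequence of positive real numbers satisfying conditions (0)–(3) of the context. Let $F\in z\mathbb{C}[[z]]$ with $F'(0)=\lambda$ and let $H$ be its linearization. 1. If $F\in z\mathbb{C}[[z]]_{(M_n)}$ and $\omega$ is a Brjuno number, then $H\in z\mathbb{C}[[z]]_{(M_n)}$. 2. If $F\in z\mathbb{C}\{z\}$ and $$\limsup_{n\to+\infty}\left(\sum_{k=0}^{k(n)}\frac{\log q_{k+1}}{q_k}-\frac1n\log M_n\right)<+\infty,$$ where $k(n)$ is defined by $q_{k(n)}\le n<q_{k(n)+1}$, then $H\in z\mathbb{C}[[z]]_{(M_n)}$. 3. Let $(N_n)_{n\ge1}$ be a sequence of positive real numbers also satisfying conditions (0)–(3) and such that $M_n\ge N_n$ for all sufficiently large $n$. If $F\in z\mathbb{C}[[z]]_{(N_n)}$ and $$\limsup_{n\to+\infty}\left(\sum_{k=0}^{k(n)}\frac{\log q_{k+1}}{q_k}-\frac1n\log\frac{M_n}{N_n}\right)<+\infty,$$ where $k(n)$ is defined by $q_{k(n)}\le n<q_{k(n)+1}$, then $H\in z\mathbb{C}[[z]]_{(M_n)}$.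
   Context: Conditions on a sequence $(M_n)_{n\ge1}$ of positive reals: (0) $\inf_{n\ge1}M_n^{1/n}>0$; (1) there exists $C_1>0$ with $M_{n+1}\le C_1^{n+1}M_n$ for all $n\ge1$; (2) $(M_n)$ is logarithmically convex, i.e. $(M_{n+1}/M_n)_{n\ge1}$ is increasing (non-decreasing); (3) $M_nM_m\le M_{m+n-1}$ for all $m,n\ge1$. A formal series $f=\sum_{n\ge1}f_nz^n\in z\mathbb{C}[[z]]$ belongs to $z\mathbb{C}[[z]]_{(M_n)}$ if there exist $c_1,c_2>0$ such that $|f_n|\le c_1c_2^nM_n$ for all $n\ge1$. $z\mathbb{C}\{z\}$ denotes the convergent power series without constant term. For $F=\sum_{n\ge1}f_nz^n\in z\mathbb{C}[[z]]$ with $f_1=\lambda=e^{2\pi i\omega}$, $\omega$ irrational, the linearization of $F$ is the unique formal series $H=z+\sum_{n\ge2}h_nz^n$ satisfying $F\circ H=H\circ R_\lambda$, $R_\lambda(z)=\lambda z$. Continued fractions: $a_0=\lfloor\omega\rfloor$, $\omega_0=\omega-\lfloor\omega\rfloor$, and for $n\ge1$, $a_n=\lfloor 1/\omega_{n-1}\rfloor$, $\omega_n=1/\omega_{n-1}-a_n$; the denominators of the convergents are $q_{-2}=1$, $q_{-1}=0$, $q_n=a_nq_{n-1}+q_{n-2}$ for $n\ge0$. $\omega$ is a Brjuno number if $\sum_{n\ge0}\frac{\log q_{n+1}}{q_n}<+\infty$. *)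

theory Defs
  imports "HOL-Analysis.Analysis" "HOL-Computational_Algebra.Formal_Power_Series"
begin

text \<open>A weight sequence is indexed by \<open>n \<ge> 1\<close>; the value \<open>M 0\<close> is irrelevant throughout.\<close>

definition weight_seq :: "(nat \<Rightarrow> real) \<Rightarrow> bool" where
  "weight_seq M \<longleftrightarrow>
     (\<forall>n\<ge>1. M n > 0) \<and>
     (INF n\<in>{1..}. M n powr (1 / real n)) > 0 \<and>
     (\<exists>C>0. \<forall>n\<ge>1. M (n + 1) \<le> C ^ (n + 1) * M n) \<and>
     mono_on {1..} (\<lambda>n. M (n + 1) / M n) \<and>
     (\<forall>m\<ge>1. \<forall>n\<ge>1. M n * M m \<le> M (m + n - 1))"

definition weighted_series :: "(nat \<Rightarrow> real) \<Rightarrow> complex fps set" where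
  "weighted_series M =
     {f. fps_nth f 0 = 0 \<and>
         (\<exists>c1>0. \<exists>c2>0. \<forall>n\<ge>1. norm (fps_nth f n) \<le> c1 * c2 ^ n * M n)}"

definition convergent_series :: "complex fps set" where
  "convergent_series = {f. fps_nth f 0 = 0 \<and> fps_conv_radius f > 0}"

definition is_linearization :: "complex fps \<Rightarrow> complex fps \<Rightarrow> bool" where
  "is_linearization F H \<longleftrightarrow>
     fps_nth H 0 = 0 \<and> fps_nth H 1 = 1 \<and>
     fps_compose F H = fps_compose H (fps_const (fps_nth F 1) * fps_X)"

definition linearization :: "complex fps \<Rightarrow> complex fps" where
  "linearization F = (THE H. is_linearization F H)"

text \<open>The description is well defined when the multiplier is nonzero and not a root of unity:
  the coefficients satisfy
  \<open>(\<lambda>^n - \<lambda>) h\<^sub>n = \<Sum>i=2..n. f\<^sub>i [z^n] H^i\<close>, whose right-hand side involves only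
  \<open>h\<^sub>1, \<dots>, h\<^bsub>n-1\<^esub>\<close>.\<close>

lemma fps_power_nth_cong_less:
  fixes A B :: "complex fps"
  assumes "\<And>k. k < n \<Longrightarrow> fps_nth A k = fps_nth B k" "m < n"
  shows "fps_nth (A ^ i) m = fps_nth (B ^ i) m"
  using assms(2)
proof (induction i arbitrary: m)
  case (Suc i)
  then show ?case
    by (auto simp: fps_mult_nth assms(1) intro!: sum.cong)
qed simp

lemma fps_power_nth_cutoff:
  fixes H :: "complex fps"
  assumes "fps_nth H 0 = 0" "2 \<le> i"
  shows "fps_nth (H ^ i) n = fps_nth (fps_cutoff n H ^ i) n"
proof -
  obtain l where i: "i = Suc (Suc l)"
    using assms(2) by (metis add_2_eq_Suc le_Suc_ex)
  have "fps_nth H j * fps_nth (H ^ Suc l) (n - j) =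
        fps_nth (fps_cutoff n H) j * fps_nth (fps_cutoff n H ^ Suc l) (n - j)"
    if j: "j \<in> {0..n}" for j
  proof -
    consider "j = 0" | "j = n" | "0 < j" "j < n" using j by fastforce
    then show ?thesis
    proof cases
      case 3
      have "fps_nth (H ^ Suc l) (n - j) = fps_nth (fps_cutoff n H ^ Suc l) (n - j)"
        by (rule fps_power_nth_cong_less[of n]) (use 3 in auto)
      then show ?thesis using 3 by simp
    qed (use assms(1) in auto)
  qed
  then show ?thesis
    unfolding i power_Suc[of _ "Suc l"] fps_mult_nth by (rule sum.cong[OF refl])
qed

lemma is_linearization_iff:
  assumes F0: "fps_nth F 0 = 0"
    and nres: "\<And>n. 2 \<le> n \<Longrightarrow> fps_nth F 1 ^ n \<noteq> fps_nth F 1"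
  shows "is_linearization F H \<longleftrightarrow>
    fps_nth H 0 = 0 \<and> fps_nth H 1 = 1 \<and>
    (\<forall>n\<ge>2. fps_nth H n =
      (\<Sum>i=2..n. fps_nth F i * fps_nth (fps_cutoff n H ^ i) n) / (fps_nth F 1 ^ n - fps_nth F 1))"
proof -
  let ?l = "fps_nth F 1"
  let ?S = "\<lambda>n. \<Sum>i=2..n. fps_nth F i * fps_nth (fps_cutoff n H ^ i) n"
  have "(fps_compose F H = fps_compose H (fps_const ?l * fps_X)) \<longleftrightarrow>
        (\<forall>n\<ge>2. fps_nth H n = ?S n / (?l ^ n - ?l))"
    if H: "fps_nth H 0 = 0" "fps_nth H 1 = 1"
  proof -
    have L: "fps_nth (fps_compose F H) n = ?l * fps_nth H n + ?S n" if "n \<ge> 2" for n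
    proof -
      have "fps_nth (fps_compose F H) n = (\<Sum>i=0..n. fps_nth F i * fps_nth (H ^ i) n)"
        by (simp add: fps_compose_nth)
      also have "\<dots> = ?l * fps_nth H n + (\<Sum>i=2..n. fps_nth F i * fps_nth (H ^ i) n)"
        using that F0 by (simp add: sum.atLeast_Suc_atMost numeral_2_eq_2)
      also have "(\<Sum>i=2..n. fps_nth F i * fps_nth (H ^ i) n) = ?S n"
        by (intro sum.cong refl) (simp add: fps_power_nth_cutoff[OF H(1)])
      finally show ?thesis .
    qed
    have eq: "(fps_nth (fps_compose F H) n = ?l ^ n * fps_nth H n) \<longleftrightarrow>
          fps_nth H n = ?S n / (?l ^ n - ?l)" if "n \<ge> 2" for n
      using nres[OF that] unfolding L[OF that]
      by (auto simp: field_simps)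
    have "(fps_nth (fps_compose F H) n = ?l ^ n * fps_nth H n)" if "\<not> n \<ge> 2" for n
    proof -
      have "n = 0 \<or> n = 1" using that by auto
      then show ?thesis using F0 H by (auto simp: fps_compose_nth)
    qed
    then show ?thesis
      unfolding fps_eq_iff fps_compose_linear using eq by (auto simp: fps_eq_iff)
  qed
  then show ?thesis unfolding is_linearization_def by blast
qed

function lin_coeff :: "complex fps \<Rightarrow> nat \<Rightarrow> complex" where
  "lin_coeff F n =
     (if n = 0 then 0 else if n = 1 then 1 else
       (\<Sum>i=2..n. fps_nth F i * fps_nth (Abs_fps (\<lambda>k. if k < n then lin_coeff F k else 0) ^ i) n)
         / (fps_nth F 1 ^ n - fps_nth F 1))"
  by pat_completeness auto
termination by (relation "Wellfounded.measure snd") auto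

declare lin_coeff.simps [simp del]

lemma ex1_linearization:
  assumes F0: "fps_nth F 0 = 0"
    and nres: "\<And>n. 2 \<le> n \<Longrightarrow> fps_nth F 1 ^ n \<noteq> fps_nth F 1"
  shows "\<exists>!H. is_linearization F H"
proof (rule ex_ex1I)
  have "fps_cutoff n (Abs_fps (lin_coeff F)) = Abs_fps (\<lambda>k. if k < n then lin_coeff F k else 0)" for n
    by (simp add: fps_eq_iff)
  moreover have "lin_coeff F 0 = 0" "lin_coeff F 1 = 1"
    by (subst lin_coeff.simps, simp)+
  moreover have "lin_coeff F n =
      (\<Sum>i=2..n. fps_nth F i * fps_nth (Abs_fps (\<lambda>k. if k < n then lin_coeff F k else 0) ^ i) n)
        / (fps_nth F 1 ^ n - fps_nth F 1)" if "n \<ge> 2" for n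
    using that by (subst lin_coeff.simps) auto
  ultimately have "is_linearization F (Abs_fps (lin_coeff F))"
    by (simp only: is_linearization_iff[OF assms] fps_nth_Abs_fps) simp
  then show "\<exists>H. is_linearization F H" ..
next
  fix G H assume G: "is_linearization F G" and H: "is_linearization F H"
  have "fps_nth G n = fps_nth H n" for n
  proof (induction n rule: less_induct)
    case (less n)
    have c: "fps_cutoff n G = fps_cutoff n H"
      using less by (simp add: fps_eq_iff)
    consider "n = 0" | "n = 1" | "n \<ge> 2" by linarith
    then show ?case
    proof cases
      case 3
      then show ?thesis
        using G H c by (simp add: is_linearization_iff[OF assms])
    qed (use G H in \<open>simp_all add: is_linearization_def\<close>)
  qed
  then show "G = H" by (simp add: fps_eq_iff)
qed

lemma is_linearization_linearization:
  assumes "fps_nth F 0 = 0"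
    and "\<And>n. 2 \<le> n \<Longrightarrow> fps_nth F 1 ^ n \<noteq> fps_nth F 1"
  shows "is_linearization F (linearization F)"
  unfolding linearization_def by (rule theI'[OF ex1_linearization[OF assms]])

lemma multiplier_power_neq:
  assumes "\<omega> \<notin> \<rat>" "2 \<le> n"
  shows "exp (2 * of_real pi * \<i> * of_real \<omega>) ^ n \<noteq> exp (2 * of_real pi * \<i> * of_real \<omega> :: complex)"
proof
  assume "exp (2 * of_real pi * \<i> * of_real \<omega>) ^ n = exp (2 * of_real pi * \<i> * of_real \<omega> :: complex)"
  then have "exp (of_nat n * (2 * of_real pi * \<i> * of_real \<omega>)) = exp (2 * of_real pi * \<i> * of_real \<omega> :: complex)"
    by (simp add: exp_of_nat_mult)
  then obtain k :: int where
    "of_nat n * (2 * of_real pi * \<i> * of_real \<omega>) = 2 * of_real pi * \<i> * of_real \<omega> + (of_int (2 * k) * pi) * \<i>"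
    unfolding exp_eq by blast
  then have "Im (of_nat n * (2 * of_real pi * \<i> * of_real \<omega>)) =
      Im (2 * of_real pi * \<i> * of_real \<omega> + (of_int (2 * k) * pi) * \<i>)"
    by simp
  then have "pi * (real n * \<omega>) = pi * (\<omega> + of_int k)"
    by (simp add: algebra_simps)
  then have "real n * \<omega> = \<omega> + of_int k"
    by (subst (asm) mult_cancel_left) simp
  then have "\<omega> = of_int k / (real n - 1)"
    using assms(2) by (simp add: field_simps)
  then have "\<omega> \<in> \<rat>" by simp
  then show False using assms(1) by contradiction
qed

fun cf_rem :: "real \<Rightarrow> nat \<Rightarrow> real" where
  "cf_rem \<omega> 0 = \<omega> - of_int \<lfloor>\<omega>\<rfloor>"
| "cf_rem \<omega> (Suc n) = 1 / cf_rem \<omega> n - of_int \<lfloor>1 / cf_rem \<omega> n\<rfloor>"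

fun cf_coeff :: "real \<Rightarrow> nat \<Rightarrow> int" where
  "cf_coeff \<omega> 0 = \<lfloor>\<omega>\<rfloor>"
| "cf_coeff \<omega> (Suc n) = \<lfloor>1 / cf_rem \<omega> n\<rfloor>"

text \<open>\<open>cf_den_shift \<omega> n\<close> is \<open>q\<^bsub>n-2\<^esub>\<close>, so that the recursion can start from
  \<open>q\<^bsub>-2\<^esub> = 1\<close> and \<open>q\<^bsub>-1\<^esub> = 0\<close>.\<close>

fun cf_den_shift :: "real \<Rightarrow> nat \<Rightarrow> int" where
  "cf_den_shift \<omega> 0 = 1"
| "cf_den_shift \<omega> (Suc 0) = 0"
| "cf_den_shift \<omega> (Suc (Suc n)) = cf_coeff \<omega> n * cf_den_shift \<omega> (Suc n) + cf_den_shift \<omega> n"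

definition cf_den :: "real \<Rightarrow> nat \<Rightarrow> int" where
  "cf_den \<omega> n = cf_den_shift \<omega> (n + 2)"

definition brjuno_term :: "real \<Rightarrow> nat \<Rightarrow> real" where
  "brjuno_term \<omega> k = ln (real_of_int (cf_den \<omega> (k + 1))) / real_of_int (cf_den \<omega> k)"

definition brjuno :: "real \<Rightarrow> bool" where
  "brjuno \<omega> \<longleftrightarrow> \<omega> \<notin> \<rat> \<and> summable (brjuno_term \<omega>)"

text \<open>For irrational \<open>\<omega>\<close> and \<open>n \<ge> 1\<close> there is exactly one such index; it may happen that
  \<open>q\<^sub>0 = q\<^sub>1 = 1\<close>, in which case the index for \<open>n = 1\<close> is 1.\<close>

definition cf_index :: "real \<Rightarrow> nat \<Rightarrow> nat" where
  "cf_index \<omega> n = (THE k. cf_den \<omega> k \<le> int n \<and> int n < cf_den \<omega> (k + 1))"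

lemma cf_rem_irrational:
  assumes "\<omega> \<notin> \<rat>"
  shows "cf_rem \<omega> n \<notin> \<rat> \<and> 0 < cf_rem \<omega> n \<and> cf_rem \<omega> n < 1"
proof -
  have step: "x - of_int \<lfloor>x\<rfloor> \<notin> \<rat> \<and> 0 < x - of_int \<lfloor>x\<rfloor> \<and> x - of_int \<lfloor>x\<rfloor> < 1" if "x \<notin> \<rat>" for x :: real
  proof -
    have "x - of_int \<lfloor>x\<rfloor> \<notin> \<rat>" using that by (metis Rats_add Rats_of_int diff_add_cancel)
    moreover from this have "x - of_int \<lfloor>x\<rfloor> \<noteq> 0" by (metis Rats_0)
    ultimately show ?thesis using of_int_floor_le[of x] floor_correct[of x] by linarith
  qed
  show ?thesis
  proof (induction n)
    case 0
    then show ?case using step[OF assms] by simp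
  next
    case (Suc n)
    then have "1 / cf_rem \<omega> n \<notin> \<rat>" by (metis Rats_inverse inverse_eq_divide inverse_inverse_eq)
    then show ?case using step by simp
  qed
qed

lemma cf_coeff_pos:
  assumes "\<omega> \<notin> \<rat>"
  shows "cf_coeff \<omega> (Suc n) \<ge> 1"
  using cf_rem_irrational[OF assms, of n] by (simp add: le_floor_iff)

lemma cf_den_0: "cf_den \<omega> 0 = 1"
  by (simp add: cf_den_def numeral_2_eq_2)

lemma cf_den_1: "cf_den \<omega> (Suc 0) = cf_coeff \<omega> (Suc 0)"
  by (simp add: cf_den_def numeral_2_eq_2)

lemma cf_den_Suc_Suc:
  "cf_den \<omega> (Suc (Suc n)) = cf_coeff \<omega> (Suc (Suc n)) * cf_den \<omega> (Suc n) + cf_den \<omega> n"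
  by (simp add: cf_den_def numeral_2_eq_2)

lemma cf_den_pos:
  assumes "\<omega> \<notin> \<rat>"
  shows "cf_den \<omega> k \<ge> 1"
proof (induction k rule: less_induct)
  case (less k)
  consider "k = 0" | "k = Suc 0" | l where "k = Suc (Suc l)"
    by (metis not0_implies_Suc)
  then show ?case
  proof cases
    case (3 l)
    then have "1 * 1 \<le> cf_coeff \<omega> (Suc (Suc l)) * cf_den \<omega> (Suc l)"
      using less.IH[of "Suc l"] cf_coeff_pos[OF assms, of "Suc l"]
      by (intro mult_mono) auto
    then show ?thesis using 3 less.IH[of l] cf_den_Suc_Suc[of \<omega> l] by simp
  qed (use cf_coeff_pos[OF assms, of 0] in \<open>simp_all add: cf_den_0 cf_den_1\<close>)
qed

lemma cf_den_mono_aux: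
  assumes "\<omega> \<notin> \<rat>"
  shows "cf_den \<omega> n \<ge> 1 \<and> cf_den \<omega> n \<le> cf_den \<omega> (Suc n) \<and> int n \<le> cf_den \<omega> n"
proof (induction n)
  case 0
  then show ?case using cf_coeff_pos[OF assms, of 0] by (simp add: cf_den_0 cf_den_1)
next
  case (Suc n)
  have "1 * cf_den \<omega> (Suc n) \<le> cf_coeff \<omega> (Suc (Suc n)) * cf_den \<omega> (Suc n)"
    using cf_coeff_pos[OF assms, of "Suc n"] Suc by (intro mult_right_mono) auto
  then have "cf_den \<omega> (Suc n) \<le> cf_den \<omega> (Suc (Suc n))"
    using Suc cf_den_Suc_Suc[of \<omega> n] by linarith
  moreover have "int (Suc n) \<le> cf_den \<omega> (Suc n)"
  proof (cases n)
    case 0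
    then show ?thesis using Suc by simp
  next
    case (Suc m)
    have pos: "cf_den \<omega> m \<ge> 1" by (rule cf_den_pos[OF assms])
    have "1 * cf_den \<omega> n \<le> cf_coeff \<omega> (Suc n) * cf_den \<omega> n"
      using cf_coeff_pos[OF assms, of n] Suc.IH by (intro mult_right_mono) auto
    then have "cf_den \<omega> n + 1 \<le> cf_den \<omega> (Suc n)"
      using pos cf_den_Suc_Suc[of \<omega> m] Suc by simp
    then show ?thesis using Suc.IH by simp
  qed
  ultimately show ?case using Suc by auto
qed

lemma ex1_cf_index:
  assumes "\<omega> \<notin> \<rat>" "n \<ge> 1"
  shows "\<exists>!k. cf_den \<omega> k \<le> int n \<and> int n < cf_den \<omega> (k + 1)"
proof (rule ex_ex1I)
  define K where "K = (LEAST k. int n < cf_den \<omega> k)"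
  have "int n < cf_den \<omega> (Suc n)"
    using cf_den_mono_aux[OF assms(1), of "Suc n"] by linarith
  then have K: "int n < cf_den \<omega> K" unfolding K_def by (rule LeastI)
  then obtain k where k: "K = Suc k"
    using assms(2) by (cases K) (auto simp: cf_den_0)
  then have "\<not> int n < cf_den \<omega> k"
    using not_less_Least[of k "\<lambda>k. int n < cf_den \<omega> k"] K_def by simp
  then show "\<exists>k. cf_den \<omega> k \<le> int n \<and> int n < cf_den \<omega> (k + 1)"
    using K k by (intro exI[of _ k]) simp
next
  have mono: "cf_den \<omega> i \<le> cf_den \<omega> j" if "i \<le> j" for i j
    using that by (rule lift_Suc_mono_le[rotated]) (use cf_den_mono_aux[OF assms(1)] in blast)
  fix i j
  assume i: "cf_den \<omega> i \<le> int n \<and> int n < cf_den \<omega> (i + 1)"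
    and j: "cf_den \<omega> j \<le> int n \<and> int n < cf_den \<omega> (j + 1)"
  have "\<not> i < j" "\<not> j < i"
    using mono[of "i + 1" j] mono[of "j + 1" i] i j by linarith+
  then show "i = j" by simp
qed

end

theory Submission
  imports Defs
begin

text \<open>
  The coefficients of \<open>H\<close> satisfy \<open>(\<lambda>\<^sup>n - \<lambda>) h\<^sub>n = \<Sum>i=2..n. f\<^sub>i [z\<^sup>n] H\<^sup>i\<close>. Unfolding the recursion
  writes \<open>h\<^sub>n\<close> as a sum over trees with \<open>n\<close> leaves: a node with \<open>i\<close> children carries the coefficient
  \<open>f\<^sub>i\<close>, and a node above \<open>j\<close> leaves is divided by \<open>\<lambda>\<^sup>j - \<lambda>\<close>, of modulus \<open>\<bar>\<lambda>\<^bsup>j-1\<^esup> - 1\<bar>\<close>. The number of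
  trees grows geometrically. If \<open>F\<close> has weight \<open>N\<close>, the inequality \<open>N a * N b \<le> N (a + b - 1)\<close>
  makes the weights of the nodes multiply to at most \<open>N n\<close>, up to a
  geometric factor. So the only issue is the product of
  small divisors along a tree.

  Following Davie, it is controlled by a function \<open>K\<close> with
  \<open>- ln \<bar>\<lambda>\<^sup>n - 1\<bar> \<le> K n - K (n - 1)\<close> and \<open>K a + K b \<le> K (a + b)\<close>: such a function dominates
  the logarithm of the product over every tree, by induction over the tree. The induction is
  carried out directly on the recursion, without trees, and gives
  \<open>\<bar>h\<^sub>n\<bar> \<le> d * A ^ n * exp (K n) * N n\<close> (\<open>linearization_majorant\<close>).

  To construct \<open>K\<close>, sort the times \<open>n\<close> at which \<open>\<lambda>\<^sup>n\<close> is near 1 by the denominators \<open>q\<^sub>k\<close>. Two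
  resonances of level \<open>k\<close> either differ by a multiple of \<open>q\<^sub>k\<close> or are at least
  \<open>q\<^bsub>k+1\<^esub> / 16\<close> apart (\<open>resonant_gap\<close>). This suffices to find a superadditive function that jumps by
  at least 1 at each of them and is at most \<open>n / q\<^sub>k + 32 n / q\<^bsub>k+1\<^esub>\<close> (\<open>resonance_count_exists\<close>). Multiplying
  by \<open>ln (4 q\<^bsub>k+1\<^esub>)\<close> and summing over \<open>q\<^sub>k \<le> n\<close> gives a \<open>K\<close> which is at most \<open>n\<close> times the
  partial Brjuno sum plus a constant multiple of \<open>n\<close>
  (\<open>superadditive_small_divisor_bound\<close>), because \<open>\<Sum>k. ln q\<^sub>k / q\<^sub>k\<close> always converges.

  Hence \<open>\<bar>h\<^sub>n\<bar> \<le> c * r ^ n * exp (n * B\<^sub>n) * N n\<close>, where \<open>B\<^sub>n\<close> is the partial Brjuno sum up to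
  \<open>k(n)\<close>. The three parts compare this bound with \<open>M n\<close>, for \<open>N = M\<close> with bounded \<open>B\<^sub>n\<close>, for
  \<open>N = 1\<close>, and for general \<open>N\<close>.
\<close>

section \<open>Continued fractions and best approximation\<close>

text \<open>
  The distance from \<open>q\<^sub>k \<omega>\<close> to the numerator \<open>p\<^sub>k\<close> of the convergent, written as the product
  \<open>\<omega>\<^sub>0 \<omega>\<^sub>1 \<dots> \<omega>\<^sub>k\<close> of the remainders. In this form positivity, monotonicity and the
  recursion are immediate, and the numerators of the convergents are only needed through the
  integrality statement below.
\<close>

definition cf_err :: "real \<Rightarrow> nat \<Rightarrow> real" where
  "cf_err \<omega> k = (\<Prod>i\<le>k. cf_rem \<omega> i)"

lemma cf_err_pos: "\<omega> \<notin> \<rat> \<Longrightarrow> cf_err \<omega> k > 0"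
  unfolding cf_err_def by (rule prod_pos) (use cf_rem_irrational in auto)

lemma cf_err_Suc_Suc:
  assumes "\<omega> \<notin> \<rat>"
  shows "cf_err \<omega> (Suc (Suc k)) = cf_err \<omega> k - of_int (cf_coeff \<omega> (Suc (Suc k))) * cf_err \<omega> (Suc k)"
proof -
  have nz: "cf_rem \<omega> (Suc k) \<noteq> 0"
    using cf_rem_irrational[OF assms, of "Suc k"] by auto
  have "cf_err \<omega> (Suc (Suc k)) = cf_err \<omega> (Suc k) * cf_rem \<omega> (Suc (Suc k))"
    by (simp add: cf_err_def del: cf_rem.simps)
  also have "cf_rem \<omega> (Suc (Suc k)) = 1 / cf_rem \<omega> (Suc k) - of_int (cf_coeff \<omega> (Suc (Suc k)))"
    by simp
  also have "cf_err \<omega> (Suc k) * (1 / cf_rem \<omega> (Suc k)) = cf_err \<omega> k"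
    using nz by (simp add: cf_err_def del: cf_rem.simps)
  then have "cf_err \<omega> (Suc k) * (1 / cf_rem \<omega> (Suc k) - of_int (cf_coeff \<omega> (Suc (Suc k)))) =
      cf_err \<omega> k - of_int (cf_coeff \<omega> (Suc (Suc k))) * cf_err \<omega> (Suc k)"
    by (simp only: right_diff_distrib mult.commute)
  finally show ?thesis .
qed

text \<open>
  This is \<open>\<bar>q\<^sub>k p\<^bsub>k+1\<^esub> - q\<^bsub>k+1\<^esub> p\<^sub>k\<bar> = 1\<close> with the numerators eliminated through
  \<open>p\<^sub>k = q\<^sub>k \<omega> - (-1)\<^sup>k cf_err \<omega> k\<close>. It gives the upper and lower bounds for \<open>cf_err\<close>.
\<close>

lemma cf_err_determinant:
  assumes "\<omega> \<notin> \<rat>"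
  shows "of_int (cf_den \<omega> (Suc k)) * cf_err \<omega> k + of_int (cf_den \<omega> k) * cf_err \<omega> (Suc k) = 1"
proof (induction k)
  case 0
  have "cf_rem \<omega> 0 \<noteq> 0"
    using cf_rem_irrational[OF assms, of 0] by auto
  then show ?case
    by (simp add: cf_den_0 cf_den_1 cf_err_def field_simps)
next
  case (Suc k)
  then show ?case
    by (simp add: cf_den_Suc_Suc cf_err_Suc_Suc[OF assms] algebra_simps)
qed

lemma cf_err_le:
  assumes "\<omega> \<notin> \<rat>"
  shows "of_int (cf_den \<omega> (Suc k)) * cf_err \<omega> k \<le> 1"
  using cf_err_determinant[OF assms, of k] cf_err_pos[OF assms, of "Suc k"] cf_den_pos[OF assms, of k]
  by (smt (verit) mult_nonneg_nonneg of_int_1_le_iff)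

lemma cf_err_Suc_less:
  assumes "\<omega> \<notin> \<rat>"
  shows "cf_err \<omega> (Suc k) < cf_err \<omega> k"
proof -
  have "cf_err \<omega> k * cf_rem \<omega> (Suc k) < cf_err \<omega> k * 1"
    using cf_err_pos[OF assms, of k] cf_rem_irrational[OF assms, of "Suc k"]
    by (intro mult_strict_left_mono) auto
  then show ?thesis by (simp add: cf_err_def del: cf_rem.simps)
qed

lemma cf_err_ge:
  assumes "\<omega> \<notin> \<rat>"
  shows "1 \<le> 2 * of_int (cf_den \<omega> (Suc k)) * cf_err \<omega> k"
proof -
  have "of_int (cf_den \<omega> k) * cf_err \<omega> (Suc k) \<le> of_int (cf_den \<omega> (Suc k)) * cf_err \<omega> k"
    using cf_den_mono_aux[OF assms, of k] cf_err_Suc_less[OF assms, of k] cf_err_pos[OF assms]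
    by (intro mult_mono) (auto intro: less_imp_le)
  then show ?thesis using cf_err_determinant[OF assms, of k] by simp
qed

text \<open>
  The two integers are \<open>p\<^sub>k\<close> and \<open>p\<^bsub>k+1\<^esub>\<close>. Both are carried through the induction because
  the recursion for them has depth two.
\<close>

lemma cf_den_times_minus_err_int:
  assumes "\<omega> \<notin> \<rat>"
  shows "of_int (cf_den \<omega> k) * \<omega> - (-1) ^ k * cf_err \<omega> k \<in> \<int> \<and>
    of_int (cf_den \<omega> (Suc k)) * \<omega> + (-1) ^ k * cf_err \<omega> (Suc k) \<in> \<int>"
proof (induction k)
  case 0
  have "cf_rem \<omega> 0 \<noteq> 0"
    using cf_rem_irrational[OF assms, of 0] by auto
  then have "cf_rem \<omega> 0 * cf_rem \<omega> (Suc 0) = 1 - of_int (cf_coeff \<omega> (Suc 0)) * (\<omega> - of_int \<lfloor>\<omega>\<rfloor>)"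
    by (simp add: field_simps)
  then have "of_int (cf_coeff \<omega> (Suc 0)) * \<omega> + cf_rem \<omega> 0 * cf_rem \<omega> (Suc 0) =
      of_int (cf_coeff \<omega> (Suc 0) * \<lfloor>\<omega>\<rfloor> + 1)"
    by (simp add: algebra_simps)
  then have "of_int (cf_coeff \<omega> (Suc 0)) * \<omega> + cf_rem \<omega> 0 * cf_rem \<omega> (Suc 0) \<in> \<int>"
    by (metis Ints_of_int)
  then show ?case
    by (simp add: cf_den_0 cf_den_1 cf_err_def del: cf_coeff.simps cf_rem.simps) simp
next
  case (Suc k)
  let ?a = "of_int (cf_coeff \<omega> (Suc (Suc k))) :: real"
  have "of_int (cf_den \<omega> (Suc (Suc k))) * \<omega> + (-1) ^ Suc k * cf_err \<omega> (Suc (Suc k)) =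
    ?a * (of_int (cf_den \<omega> (Suc k)) * \<omega> + (-1) ^ k * cf_err \<omega> (Suc k)) +
      (of_int (cf_den \<omega> k) * \<omega> - (-1) ^ k * cf_err \<omega> k)"
    by (simp add: cf_den_Suc_Suc cf_err_Suc_Suc[OF assms] algebra_simps)
  also have "\<dots> \<in> \<int>"
    by (rule Ints_add[OF Ints_mult[OF Ints_of_int]]) (use Suc in simp_all)
  finally show ?case using Suc by simp
qed

text \<open>
  By the determinant identity \<open>(j, p)\<close> is an integer combination of \<open>(q\<^sub>k, p\<^sub>k)\<close> and
  \<open>(q\<^bsub>k+1\<^esub>, p\<^bsub>k+1\<^esub>)\<close>. Their errors have opposite signs, while \<open>0 < j < q\<^bsub>k+1\<^esub>\<close> forces
  opposite signs of the two coefficients as well; hence the errors add up instead of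
  cancelling, and the one of \<open>q\<^sub>k\<close> occurs at least once.
\<close>

lemma best_approximation:
  assumes "\<omega> \<notin> \<rat>" "0 < j" "j < cf_den \<omega> (Suc k)"
  shows "cf_err \<omega> k \<le> \<bar>of_int j * \<omega> - of_int p\<bar>"
proof -
  define s :: int where "s = (-1) ^ k"
  have ss: "s * s = 1" by (simp add: s_def flip: power_add)
  define q q' where "q = cf_den \<omega> k" and "q' = cf_den \<omega> (Suc k)"
  define b b' where "b = cf_err \<omega> k" and "b' = cf_err \<omega> (Suc k)"
  obtain P P' :: int where "of_int q * \<omega> - (-1) ^ k * b = of_int P" "of_int q' * \<omega> + (-1) ^ k * b' = of_int P'"
    using cf_den_times_minus_err_int[OF assms(1), of k] unfolding q_def q'_def b_def b'_def Ints_def by blast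
  then have P: "of_int q * \<omega> = of_int P + of_int s * b" "of_int q' * \<omega> = of_int P' - of_int s * b'"
    by (simp_all add: s_def algebra_simps)
  have det: "of_int q' * b + of_int q * b' = 1"
    using cf_err_determinant[OF assms(1)] by (simp add: q_def q'_def b_def b'_def)
  have b: "b > 0" "b' > 0" using cf_err_pos[OF assms(1)] by (auto simp: b_def b'_def)
  have q: "q \<ge> 1" "q' \<ge> 1" using cf_den_pos[OF assms(1)] by (auto simp: q_def q'_def)
  have ssr: "real_of_int s * real_of_int s = 1"
    using ss by (metis of_int_1 of_int_mult)
  have "real_of_int (s * (q * P' - q' * P)) = 1"
  proof -
    have "real_of_int s * (of_int q * (of_int q' * \<omega> + of_int s * b') - of_int q' * (of_int q * \<omega> - of_int s * b))
      = (of_int s * of_int s) * (of_int q' * b + of_int q * b')"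
      by (simp add: algebra_simps)
    then show ?thesis using P det ssr by simp
  qed
  then have detP: "s * (q * P' - q' * P) = 1" by linarith
  \<comment> \<open>up to the common sign \<open>s\<close> and the sign of \<open>v\<close>, the coordinates of \<open>(j, p)\<close> in the
    basis of the two consecutive convergents, by Cramer's rule\<close>
  define u v where "u = j * P' - p * q'" and "v = j * P - p * q"
  have jeq: "j = s * (u * q - v * q')"
  proof -
    have "s * (u * q - v * q') = (s * (q * P' - q' * P)) * j"
      unfolding u_def v_def by (simp add: algebra_simps)
    then show ?thesis using detP by simp
  qed
  have peq: "p = s * (u * P - v * P')"
  proof -
    have "s * (u * P - v * P') = (s * (q * P' - q' * P)) * p"
      unfolding u_def v_def by (simp add: algebra_simps)
    then show ?thesis using detP by simp
  qed
  have err: "of_int q * \<omega> - of_int P = of_int s * b" "of_int q' * \<omega> - of_int P' = - (of_int s * b')"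
    using P by simp_all
  have form: "of_int j * \<omega> - of_int p = of_int u * b + of_int v * b'"
  proof -
    have "of_int j * \<omega> - of_int p =
       of_int s * (of_int u * (of_int q * \<omega> - of_int P) - of_int v * (of_int q' * \<omega> - of_int P'))"
      by (subst jeq, subst peq) (simp add: algebra_simps)
    also have "\<dots> = (of_int s * of_int s) * (of_int u * b + of_int v * b')"
      unfolding err by (simp add: algebra_simps)
    finally show ?thesis using ssr by simp
  qed
  have s: "s = 1 \<or> s = -1" using ss by (metis zmult_eq_1_iff)
  have jb: "\<bar>u * q - v * q'\<bar> = j" using jeq s assms(2) by auto
  have j: "j < q'" using assms(3) by (simp add: q'_def)
  have u0: "u \<noteq> 0"
  proof
    assume "u = 0"
    then have "\<bar>v\<bar> * q' = j" using jb q by (simp add: abs_mult)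
    moreover from this have "\<bar>v\<bar> \<ge> 1" using assms(2) by (cases "v = 0") auto
    ultimately have "1 * q' \<le> j" using q by (metis mult_right_mono order.trans zero_le_one)
    then show False using j by simp
  qed
  have opp: False if "x \<ge> 1" "y \<ge> 1" "\<bar>x * q + y * q'\<bar> = j" for x y
  proof -
    have "1 * q' \<le> y * q'" using that q by (intro mult_right_mono) auto
    moreover have "0 \<le> x * q" using that q by simp
    ultimately show False using j that(3) by linarith
  qed
  show ?thesis
  proof (cases "u > 0")
    case True
    then have "v \<ge> 0" using opp[of u "- v"] jb by (cases "v \<ge> 0") auto
    then have "of_int u * b + of_int v * b' \<ge> 1 * b + 0"
      using True b by (intro add_mono mult_right_mono mult_nonneg_nonneg) auto
    then show ?thesis using form by (simp add: b_def)
  next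
    case False
    then have u: "u \<le> -1" using u0 by simp
    then have "v \<le> 0" using opp[of "-u" v] jb by (cases "v \<le> 0") (auto simp: abs_minus_commute)
    then have "of_int (-u) * b + of_int (-v) * b' \<ge> 1 * b + 0"
      using u b by (intro add_mono mult_right_mono mult_nonneg_nonneg) auto
    then show ?thesis using form by (simp add: b_def)
  qed
qed

section \<open>Small divisors and their resonances\<close>

text \<open>
  The analysis of resonances uses only that \<open>n \<mapsto> \<bar>\<lambda>\<^sup>n - 1\<bar>\<close> is subadditive and has the size of the
  distance from \<open>n \<omega>\<close> to the integers.
\<close>

definition small_divisor :: "real \<Rightarrow> nat \<Rightarrow> real" where
  "small_divisor \<omega> n = norm (exp (2 * of_real pi * \<i> * of_real \<omega>) ^ n - 1 :: complex)"

lemma small_divisor_eq: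
  assumes "p \<in> \<int>"
  shows "small_divisor \<omega> n = 2 * \<bar>sin (pi * (real n * \<omega> - p))\<bar>"
proof -
  obtain k where k: "p = of_int k" using assms by (auto simp: Ints_def)
  have "exp (2 * of_real pi * \<i> * of_real \<omega>) ^ n = (exp (\<i> * of_real (2 * pi * (real n * \<omega>))) :: complex)"
    by (simp add: mult_ac flip: exp_of_nat_mult)
  also have "\<dots> = exp (\<i> * of_real (2 * pi * (real n * \<omega> - p)))"
    unfolding exp_eq by (intro exI[of _ k]) (simp add: k algebra_simps)
  finally show ?thesis
    unfolding small_divisor_def by (simp only: dist_exp_i_1) simp
qed

lemma small_divisor_le:
  assumes "p \<in> \<int>"
  shows "small_divisor \<omega> n \<le> 2 * pi * \<bar>real n * \<omega> - p\<bar>"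
  using abs_sin_x_le_abs_x[of "pi * (real n * \<omega> - p)"] by (simp add: small_divisor_eq[OF assms] abs_mult)

text \<open>
  The bound \<open>8/5\<close> exceeds \<open>\<pi>/2\<close>, which is the range needed for \<open>\<pi> y\<close> with \<open>\<bar>y\<bar> \<le> 1/2\<close>.
\<close>

lemma abs_sin_ge_half:
  fixes x :: real
  assumes "\<bar>x\<bar> \<le> 8/5"
  shows "\<bar>x\<bar> / 2 \<le> \<bar>sin x\<bar>"
proof -
  have "\<bar>sin x - x\<bar> \<le> \<bar>x\<bar> ^ 3 / 6"
    using Maclaurin_sin_bound[of x 3] by (simp add: eval_nat_numeral sin_coeff_def)
  moreover have "\<bar>x\<bar> ^ 3 / 6 \<le> \<bar>x\<bar> / 2"
  proof -
    have "\<bar>x\<bar> * \<bar>x\<bar> \<le> 8/5 * (8/5)" using assms by (intro mult_mono) auto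
    then have "\<bar>x\<bar> * \<bar>x\<bar> * \<bar>x\<bar> \<le> 3 * \<bar>x\<bar>" by (intro mult_right_mono) auto
    then show ?thesis by (simp add: power3_eq_cube)
  qed
  ultimately show ?thesis by linarith
qed

lemma small_divisor_ge:
  assumes "\<And>p. c \<le> \<bar>real n * \<omega> - of_int p\<bar>"
  shows "2 * c \<le> small_divisor \<omega> n"
proof -
  define y where "y = real n * \<omega> - of_int (round (real n * \<omega>))"
  have y: "\<bar>y\<bar> \<le> 1/2"
    using of_int_round_abs_le[of "real n * \<omega>"] by (simp add: y_def abs_minus_commute)
  have pi: "3 \<le> pi" "pi \<le> 16/5" using pi_approx by auto
  have "pi * \<bar>y\<bar> \<le> 16/5 * (1/2)" using y pi by (intro mult_mono) auto
  then have "\<bar>pi * y\<bar> / 2 \<le> \<bar>sin (pi * y)\<bar>"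
    by (intro abs_sin_ge_half) (simp add: abs_mult)
  moreover have "2 * \<bar>y\<bar> \<le> \<bar>pi * y\<bar>"
    using pi by (simp add: abs_mult mult_right_mono)
  moreover have "c \<le> \<bar>y\<bar>" unfolding y_def by (rule assms)
  ultimately show ?thesis
    unfolding small_divisor_eq[OF Ints_of_int[of "round (real n * \<omega>)"]] y_def[symmetric] by linarith
qed

lemma small_divisor_cf_den_le:
  assumes "\<omega> \<notin> \<rat>" "cf_den \<omega> k = int q"
  shows "small_divisor \<omega> q \<le> 2 * pi / of_int (cf_den \<omega> (Suc k))"
proof -
  let ?p = "of_int (cf_den \<omega> k) * \<omega> - (-1) ^ k * cf_err \<omega> k"
  have "small_divisor \<omega> q \<le> 2 * pi * \<bar>real q * \<omega> - ?p\<bar>"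
    by (rule small_divisor_le) (use cf_den_times_minus_err_int[OF assms(1)] in blast)
  also have "\<bar>real q * \<omega> - ?p\<bar> = cf_err \<omega> k"
    using assms(2) cf_err_pos[OF assms(1), of k] by (simp add: abs_mult power_abs)
  also have "cf_err \<omega> k \<le> 1 / of_int (cf_den \<omega> (Suc k))"
    using cf_err_le[OF assms(1), of k] cf_den_pos[OF assms(1), of "Suc k"]
    by (simp add: field_simps)
  finally show ?thesis by (simp add: mult_left_mono)
qed

lemma small_divisor_below_cf_den:
  assumes "\<omega> \<notin> \<rat>" "0 < j" "int j < cf_den \<omega> k"
  shows "1 / of_int (cf_den \<omega> k) \<le> small_divisor \<omega> j"
proof -
  obtain l where l: "k = Suc l"
    using assms(2,3) by (cases k) (auto simp: cf_den_0)
  have "2 * cf_err \<omega> l \<le> small_divisor \<omega> j"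
    by (rule small_divisor_ge) (use best_approximation[of \<omega> "int j" l] assms l in auto)
  moreover have "1 / of_int (cf_den \<omega> k) \<le> 2 * cf_err \<omega> l"
    using cf_err_ge[OF assms(1), of l] cf_den_pos[OF assms(1), of k] by (simp add: l field_simps)
  ultimately show ?thesis by linarith
qed

lemma norm_unit_power_diff:
  fixes z :: complex
  assumes "norm z = 1" "m \<le> n"
  shows "norm (z ^ (n - m) - 1) \<le> norm (z ^ n - 1) + norm (z ^ m - 1)"
proof -
  have "z ^ n = z ^ m * z ^ (n - m)" using assms(2) by (simp flip: power_add)
  then have "(z ^ n - 1) - (z ^ m - 1) = z ^ m * (z ^ (n - m) - 1)"
    by (simp add: algebra_simps)
  then have "norm ((z ^ n - 1) - (z ^ m - 1)) = norm (z ^ (n - m) - 1)"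
    using assms(1) by (simp add: norm_mult norm_power)
  then show ?thesis by (metis norm_triangle_ineq4)
qed

lemma small_divisor_diff:
  "m \<le> n \<Longrightarrow> small_divisor \<omega> (n - m) \<le> small_divisor \<omega> n + small_divisor \<omega> m"
  unfolding small_divisor_def by (rule norm_unit_power_diff) simp_all

lemma small_divisor_mult: "small_divisor \<omega> (s * q) \<le> real s * small_divisor \<omega> q"
proof (induction s)
  case 0
  then show ?case by (simp add: small_divisor_def)
next
  case (Suc s)
  let ?z = "exp (2 * of_real pi * \<i> * of_real \<omega>) :: complex"
  have "?z ^ (Suc s * q) - 1 = ?z ^ q * (?z ^ (s * q) - 1) + (?z ^ q - 1)"
    by (simp add: algebra_simps power_add)
  then have "small_divisor \<omega> (Suc s * q) \<le> norm (?z ^ q * (?z ^ (s * q) - 1)) + norm (?z ^ q - 1)"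
    unfolding small_divisor_def by (metis norm_triangle_ineq)
  also have "norm (?z ^ q * (?z ^ (s * q) - 1)) = small_divisor \<omega> (s * q)"
    unfolding small_divisor_def by (simp add: norm_mult norm_power)
  finally show ?case using Suc by (simp add: small_divisor_def algebra_simps)
qed

text \<open>
  The times at which \<open>\<lambda>\<^sup>n\<close> is closer to 1 than any power with a positive exponent
  below \<open>q\<^sub>k\<close>. If \<open>k\<close>
  is the last index for which \<open>n\<close> is resonant, then \<open>ln (4 q\<^bsub>k+1\<^esub>)\<close> bounds
  \<open>- ln \<bar>\<lambda>\<^sup>n - 1\<bar>\<close>.
\<close>

definition resonant :: "real \<Rightarrow> nat \<Rightarrow> nat set" where
  "resonant \<omega> k = {n. n > 0 \<and> small_divisor \<omega> n < 1 / (4 * of_int (cf_den \<omega> k))}"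

lemma resonant_ge:
  assumes "\<omega> \<notin> \<rat>" "n \<in> resonant \<omega> k"
  shows "cf_den \<omega> k \<le> int n"
proof (rule ccontr)
  assume "\<not> ?thesis"
  then have "1 / of_int (cf_den \<omega> k) \<le> small_divisor \<omega> n"
    using assms by (intro small_divisor_below_cf_den) (auto simp: resonant_def)
  moreover have "small_divisor \<omega> n < 1 / (4 * of_int (cf_den \<omega> k))"
    using assms(2) by (simp add: resonant_def)
  ultimately show False using cf_den_pos[OF assms(1), of k] by (simp add: field_simps)
qed

text \<open>
  Write \<open>n - m = s q\<^sub>k + r\<close> with \<open>0 < r < q\<^sub>k\<close>. The divisor at \<open>r\<close> is at least \<open>1 / q\<^sub>k\<close>, whereas
  those at \<open>n\<close> and \<open>m\<close> account for at most half of it; the other half has to come from \<open>s\<close>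
  steps of length \<open>q\<^sub>k\<close>, each moving by at most \<open>2 \<pi> / q\<^bsub>k+1\<^esub>\<close>. So resonances that do not differ
  by a multiple of \<open>q\<^sub>k\<close> lie at least \<open>q\<^bsub>k+1\<^esub> / 16\<close> apart. The value \<open>m = 0\<close> is allowed because
  its divisor vanishes.
\<close>

lemma resonant_gap:
  assumes "\<omega> \<notin> \<rat>" "n \<in> resonant \<omega> k" "m = 0 \<or> m \<in> resonant \<omega> k" "m < n" "cf_den \<omega> k = int q"
    "\<not> q dvd (n - m)"
  shows "2 \<le> 32 / of_int (cf_den \<omega> (Suc k)) * real (n - m)"
proof -
  let ?Q = "real_of_int (cf_den \<omega> (Suc k))"
  have q: "q > 0" using cf_den_pos[OF assms(1), of k] assms(5) by simp
  have Q: "?Q > 0" using cf_den_pos[OF assms(1), of "Suc k"] by simp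
  define r s where "r = (n - m) mod q" and "s = (n - m) div q"
  have nm: "n - m = s * q + r" by (simp add: r_def s_def)
  have r: "0 < r" "r < q" using assms(6) q by (auto simp: r_def dvd_eq_mod_eq_0)
  have "1 / real q \<le> small_divisor \<omega> r"
    using small_divisor_below_cf_den[OF assms(1), of r k] r assms(5) by simp
  also have "\<dots> \<le> small_divisor \<omega> (n - m) + small_divisor \<omega> (s * q)"
    using small_divisor_diff[of "s * q" "n - m" \<omega>] by (simp add: nm)
  also have "small_divisor \<omega> (n - m) \<le> small_divisor \<omega> n + small_divisor \<omega> m"
    using assms(4) by (intro small_divisor_diff) auto
  also have "small_divisor \<omega> n + small_divisor \<omega> m \<le> 1 / (4 * real q) + 1 / (4 * real q)"
    using assms(2,3,5) by (intro add_mono) (auto simp: resonant_def small_divisor_def)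
  also have "small_divisor \<omega> (s * q) \<le> real s * (2 * pi / ?Q)"
    using small_divisor_mult[of \<omega> s q] small_divisor_cf_den_le[OF assms(1,5)]
    by (meson mult_left_mono of_nat_0_le_iff order_trans)
  finally have "1 / (2 * real q) \<le> real s * (2 * pi / ?Q)" by simp
  then have "?Q \<le> (real q * real s) * (4 * pi)"
    using q Q by (simp add: field_simps)
  also have "\<dots> \<le> real (n - m) * 16"
    using pi_less_4 by (intro mult_mono) (auto simp: nm mult.commute simp flip: of_nat_mult)
  finally show ?thesis using Q by (simp add: field_simps)
qed

section \<open>A superadditive function that counts resonances\<close>

text \<open>
  The heart of the small divisor estimate. A function \<open>g\<close> that is superadditive and jumps by at least 1
  at every point of \<open>A\<close> bounds the number of nodes with size in \<open>A\<close> of any tree with \<open>n\<close> leaves; the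
  claim is that it can be chosen of size \<open>n / q\<close> up to a small multiple of \<open>n\<close>.

  If \<open>A\<close> consisted of multiples of \<open>q\<close> only, \<open>n div q\<close> would do. In general \<open>g\<close> is the maximum
  of this function, of the affine function \<open>lin\<close>, and of the staircases \<open>step m\<close> that start at
  height \<open>lin m + 1\<close> in a point \<open>m\<close> of \<open>A\<close> and climb by 1 every \<open>q\<close> units. The constant \<open>-2\<close> in
  \<open>lin\<close> pays for superadditivity: no staircase exceeds \<open>lin + 1\<close>, so two of them still add up to
  at most \<open>lin\<close>. A point of \<open>A\<close> lying on an older staircase, that is, at a distance from its start
  which is a multiple of \<open>q\<close>, sees the jump of that staircase. Any other point is so far away that
  the extra slope \<open>c\<close> of \<open>lin\<close> has already lifted its new staircase by 1 over the old one. The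
  function \<open>lin\<close> is admitted only from \<open>q\<close> on, so that \<open>g\<close> vanishes below \<open>q\<close>.
\<close>

lemma resonance_count_exists:
  fixes q :: nat and c :: real and A :: "nat set"
  assumes q: "q > 0" and c: "c \<ge> 0"
    and ge: "\<And>n. n \<in> A \<Longrightarrow> q \<le> n"
    and gap: "\<And>m n. n \<in> A \<Longrightarrow> m = 0 \<or> m \<in> A \<Longrightarrow> m < n \<Longrightarrow> \<not> q dvd (n - m) \<Longrightarrow> 2 \<le> c * real (n - m)"
  shows "\<exists>g. (\<forall>a b. g a + g b \<le> g (a + b)) \<and> (\<forall>n\<in>A. g (n - 1) + 1 \<le> g n) \<and>
    (\<forall>n. 0 \<le> g n) \<and> (\<forall>n. g n \<le> (1 / real q + c) * real n) \<and> (\<forall>n<q. g n = 0)"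
proof -
  define lin where "lin n = real n / real q + c * real n - 2" for n :: nat
  define step where "step m n = lin m + 1 + real ((n - m) div q)" for m n :: nat
  define S where "S n = {real (n div q)} \<union> {x. x = lin n \<and> q \<le> n} \<union> (\<lambda>m. step m n) ` {m \<in> A. m \<le> n}"
    for n :: nat
  have lin_add: "lin (a + b) = lin a + lin b + 2" for a b
    by (simp add: lin_def add_divide_distrib algebra_simps)
  have lin_ge: "real (n div q) - 2 \<le> lin n" for n
    using of_nat_div_le_of_nat[of n q, where 'a = real] mult_nonneg_nonneg[OF c, of "real n"]
    unfolding lin_def by linarith
  have div_add: "real (a div q) + real (b div q) \<le> real ((a + b) div q)" for a b
    using div_add1_eq[of a b q] by linarith
  have step_le: "step m n \<le> lin n + 1" if "m \<le> n" for m n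
    using lin_add[of m "n - m"] lin_ge[of "n - m"] that by (simp add: step_def)
  have fin: "finite (S n)" for n
    by (rule finite_subset[of _ "{real (n div q), lin n} \<union> (\<lambda>m. step m n) ` {..n}"]) (auto simp: S_def)
  have S_cases: "x = real (n div q) \<or> (x = lin n \<and> q \<le> n) \<or> (\<exists>m\<in>A. m \<le> n \<and> x = step m n)"
    if "x \<in> S n" for x n
    using that by (auto simp: S_def)
  have S_div: "real (n div q) \<in> S n" for n by (simp add: S_def)
  have S_lin: "lin n \<in> S n" if "q \<le> n" for n using that by (simp add: S_def)
  have S_step: "step m n \<in> S n" if "m \<in> A" "m \<le> n" for m n using that by (auto simp: S_def)
  define g where "g n = Max (S n)" for n
  have g_ge: "x \<le> g n" if "x \<in> S n" for x n
    unfolding g_def using fin that by (rule Max_ge)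
  have g_in: "g n \<in> S n" for n
    unfolding g_def using fin S_div by (intro Max_in) auto
  have super: "g a + g b \<le> g (a + b)" for a b
  proof -
    have shift: "real (a div q) + step m b \<le> step m (a + b)" if "m \<le> b" for a b m
      using div_add[of a "b - m"] that by (simp add: step_def)
    have div_lin: "real (a div q) + lin b \<le> lin (a + b)" for a b
      using lin_add[of a b] lin_ge[of a] by linarith
    have g_cases: "g n = real (n div q) \<or> q \<le> n \<and> g n \<le> lin n + 1 \<and>
        (g n = lin n \<or> (\<exists>m\<in>A. m \<le> n \<and> g n = step m n))" for n
      using S_cases[OF g_in[of n]] step_le[of _ n] ge by fastforce
    consider
        "g a = real (a div q)" "g b = real (b div q)"
      | "g a = real (a div q)" "g b = lin b" "q \<le> b"
      | m where "g a = real (a div q)" "m \<in> A" "m \<le> b" "g b = step m b"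
      | "g a = lin a" "g b = real (b div q)" "q \<le> a"
      | m where "g b = real (b div q)" "m \<in> A" "m \<le> a" "g a = step m a"
      | "g a \<le> lin a + 1" "g b \<le> lin b + 1" "q \<le> a"
      using g_cases[of a] g_cases[of b] by blast
    then show ?thesis
    proof cases
      case 1
      then show ?thesis using div_add[of a b] g_ge[OF S_div[of "a + b"]] by linarith
    next
      case 2
      then show ?thesis using div_lin[of a b] g_ge[OF S_lin[of "a + b"]] by linarith
    next
      case 3
      then show ?thesis using shift[of m b a] g_ge[OF S_step[of m "a + b"]] by linarith
    next
      case 4
      then show ?thesis using div_lin[of b a] g_ge[OF S_lin[of "a + b"]] by (simp add: add.commute)
    next
      case 5
      then show ?thesis using shift[of m a b] g_ge[OF S_step[of m "a + b"]] by (simp add: add.commute)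
    next
      case 6
      then show ?thesis using lin_add[of a b] g_ge[OF S_lin[of "a + b"]] by linarith
    qed
  qed
  have jump: "g (n - 1) + 1 \<le> g n" if n: "n \<in> A" for n
  proof -
    have n0: "n > 0" using ge[OF n] q by linarith
    have top: "lin n + 1 \<le> g n" using g_ge[OF S_step[OF n order_refl]] by (simp add: step_def)
    have div_pred: "real ((j - 1) div q) + 1 = real (j div q)" if j: "q dvd j" "j > 0" for j
    proof -
      obtain l where l: "j = q * l" using j(1) by (rule dvdE)
      obtain i where "l = Suc i" using l j(2) by (cases l) auto
      with l have i: "j = q * Suc i" by simp
      then have "j - 1 = q * i + (q - 1)" using q by simp
      then have "(j - 1) div q = i" using q by (simp only: div_mult_self4) simp
      then show ?thesis using i q by simp
    qed
    \<comment> \<open>the gain \<open>c (n - m)\<close> of \<open>lin\<close> over a staircase, which is at least 2 across a gap\<close>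
    have lin_diff: "lin m + real ((n - m - 1) div q) + c * real (n - m) \<le> lin n" if "m < n" for m
    proof -
      have "real ((n - m - 1) div q) \<le> real ((n - m) div q)" by (simp add: div_le_mono)
      also have "\<dots> \<le> real (n - m) / real q" by (rule of_nat_div_le_of_nat)
      finally show ?thesis using lin_add[of m "n - m"] that by (simp add: lin_def)
    qed
    consider "g (n - 1) = real ((n - 1) div q)" | "g (n - 1) = lin (n - 1)"
      | m where "m \<in> A" "m \<le> n - 1" "g (n - 1) = step m (n - 1)"
      using S_cases[OF g_in[of "n - 1"]] by blast
    then show ?thesis
    proof cases
      case 1
      show ?thesis
      proof (cases "q dvd n")
        case True
        then show ?thesis using 1 div_pred[OF True n0] g_ge[OF S_div[of n]] by simp
      next
        case False
        then have "2 \<le> c * real n" using gap[OF n, of 0] n0 by simp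
        then show ?thesis using 1 lin_diff[OF n0] top by (simp add: lin_def)
      qed
    next
      case 2
      have "lin (n - 1) \<le> lin n"
        using lin_diff[of "n - 1"] n0 c by simp
      then show ?thesis using 2 top by linarith
    next
      case 3
      then have mn: "m < n" using n0 by simp
      show ?thesis
      proof (cases "q dvd (n - m)")
        case True
        then have "step m (n - 1) + 1 = step m n"
          using div_pred[OF True] mn by (simp add: step_def)
        then show ?thesis using 3 g_ge[OF S_step[of m n]] mn by simp
      next
        case False
        then have "2 \<le> c * real (n - m)" using gap[OF n, of m] 3 mn by simp
        then show ?thesis using 3 lin_diff[OF mn] top by (simp add: step_def)
      qed
    qed
  qed
  have nonneg: "0 \<le> g n" for n
    using g_ge[OF S_div[of n]] by (rule order_trans[rotated]) simp
  have upper: "g n \<le> (1 / real q + c) * real n" for n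
  proof -
    have "x \<le> lin n + 2" if "x \<in> S n" for x
      using S_cases[OF that] lin_ge[of n] step_le[of _ n] by fastforce
    then show ?thesis using g_in[of n] by (force simp: lin_def algebra_simps)
  qed
  have vanish: "g n = 0" if "n < q" for n
    using S_cases[OF g_in[of n]] ge that by fastforce
  show ?thesis
    using super jump nonneg upper vanish by blast
qed

lemma cf_den_mono:
  assumes "\<omega> \<notin> \<rat>" "i \<le> j"
  shows "cf_den \<omega> i \<le> cf_den \<omega> j"
  using assms(2) by (rule lift_Suc_mono_le[rotated]) (use cf_den_mono_aux[OF assms(1)] in blast)

lemma cf_index_spec:
  assumes "\<omega> \<notin> \<rat>" "n \<ge> 1"
  shows "cf_den \<omega> (cf_index \<omega> n) \<le> int n" "int n < cf_den \<omega> (Suc (cf_index \<omega> n))"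
  using theI'[OF ex1_cf_index[OF assms]] by (simp_all add: cf_index_def)

lemma brjuno_term_nonneg: "\<omega> \<notin> \<rat> \<Longrightarrow> 0 \<le> brjuno_term \<omega> k"
  using cf_den_pos[of \<omega> k] cf_den_pos[of \<omega> "k + 1"] by (simp add: brjuno_term_def)

text \<open>
  Because \<open>q\<^bsub>k+2\<^esub> \<ge> 2 q\<^sub>k\<close>; the factor \<open>sqrt 2\<close> on the right covers the first step, where
  \<open>q\<^sub>0 = q\<^sub>1 = 1\<close> may hold.
\<close>

lemma cf_den_growth:
  assumes "\<omega> \<notin> \<rat>"
  shows "sqrt 2 ^ k \<le> sqrt 2 * of_int (cf_den \<omega> k)"
proof (induction k rule: induct_nat_012)
  case 0
  then show ?case by (simp add: cf_den_0)
next
  case 1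
  then show ?case using cf_den_pos[OF assms, of 1] by simp
next
  case (ge2 k)
  have "1 * cf_den \<omega> (Suc k) \<le> cf_coeff \<omega> (Suc (Suc k)) * cf_den \<omega> (Suc k)"
    using cf_coeff_pos[OF assms, of "Suc k"] cf_den_pos[OF assms, of "Suc k"]
    by (intro mult_right_mono) auto
  then have "2 * cf_den \<omega> k \<le> cf_den \<omega> (Suc (Suc k))"
    using cf_den_mono[OF assms, of k "Suc k"] by (simp add: cf_den_Suc_Suc)
  then have "2 * real_of_int (cf_den \<omega> k) \<le> of_int (cf_den \<omega> (Suc (Suc k)))" by linarith
  moreover have "sqrt 2 ^ Suc (Suc k) = 2 * sqrt 2 ^ k"
    by (simp flip: mult.assoc)
  moreover have "2 * sqrt 2 ^ k \<le> sqrt 2 * (2 * real_of_int (cf_den \<omega> k))" using ge2(1) by simp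
  ultimately show ?case
    by (smt (verit) mult_left_mono real_sqrt_ge_zero)
qed

text \<open>
  These are the error terms in the estimate of small divisors. The numerator is at most
  \<open>2 sqrt q\<^sub>k\<close>, and the \<open>q\<^sub>k\<close> grow geometrically.
\<close>

lemma summable_log_over_cf_den:
  assumes "\<omega> \<notin> \<rat>"
  shows "summable (\<lambda>k. (2 + ln (of_int (cf_den \<omega> k))) / of_int (cf_den \<omega> k) :: real)"
proof (rule summable_comparison_test')
  define s where "s = sqrt (sqrt 2)"
  have s: "s > 1" by (simp add: s_def)
  show "summable (\<lambda>k. 2 * s * (1 / s) ^ k)"
    using s by (intro summable_mult summable_geometric) simp
  fix k :: nat
  assume "0 \<le> k"
  define x :: real where "x = of_int (cf_den \<omega> k)"
  have x: "x \<ge> 1" using cf_den_pos[OF assms, of k] by (simp add: x_def)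
  have "ln x / 2 \<le> sqrt x - 1"
    using ln_le_minus_one[of "sqrt x"] x by (simp add: ln_sqrt)
  then have "(2 + ln x) / x \<le> 2 * sqrt x / x"
    using x by (intro divide_right_mono) auto
  also have "\<dots> = 2 / sqrt x" using x by (simp add: field_simps)
  also have "\<dots> \<le> 2 * s * (1 / s) ^ k"
  proof -
    have "sqrt (sqrt 2 ^ k) \<le> sqrt (sqrt 2 * x)"
      unfolding x_def by (rule real_sqrt_le_mono[OF cf_den_growth[OF assms]])
    then have "s ^ k \<le> s * sqrt x" by (simp add: s_def real_sqrt_power real_sqrt_mult)
    then show ?thesis using s x by (simp add: field_simps)
  qed
  finally show "norm ((2 + ln (of_int (cf_den \<omega> k))) / of_int (cf_den \<omega> k) :: real) \<le> 2 * s * (1 / s) ^ k"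
    using x by (simp add: x_def)
qed

text \<open>
  The function \<open>K\<close> adds up the resonance counts for all \<open>q\<^sub>k\<close>, each weighted by the largest
  logarithm \<open>L k = ln (4 q\<^bsub>k+1\<^esub>)\<close> that it has to pay for; a divisor is charged to the last index at
  which it is resonant, and \<open>ln 4\<close> per step pays for the divisors that are nowhere resonant. The
  count for \<open>k\<close> contributes at most \<open>n (1 / q\<^sub>k + 32 / q\<^bsub>k+1\<^esub>) L k\<close>, and only if \<open>q\<^sub>k \<le> n\<close>. Its
  main part is \<open>n\<close> times the Brjuno term, with coefficient exactly 1; the rest is summable in
  \<open>k\<close>.
\<close>

lemma superadditive_small_divisor_bound:
  assumes \<omega>: "\<omega> \<notin> \<rat>"
  shows "\<exists>K C. (\<forall>a b. K a + K b \<le> K (a + b)) \<and> (\<forall>n. 0 \<le> K n) \<and>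
    (\<forall>n\<ge>1. exp (K (n - 1)) \<le> small_divisor \<omega> n * exp (K n)) \<and>
    (\<forall>n\<ge>1. K n \<le> real n * ((\<Sum>k=0..cf_index \<omega> n. brjuno_term \<omega> k) + C))"
proof -
  define Q :: "nat \<Rightarrow> real" where "Q k = of_int (cf_den \<omega> k)" for k
  have Q: "Q k \<ge> 1" for k using cf_den_pos[OF \<omega>, of k] by (simp add: Q_def)
  have Q_ge: "real k \<le> Q k" for k
    using cf_den_mono_aux[OF \<omega>, of k] unfolding Q_def by linarith
  have "\<exists>g. (\<forall>a b. g a + g b \<le> g (a + b)) \<and> (\<forall>n\<in>resonant \<omega> k. g (n - 1) + 1 \<le> g n) \<and>
    (\<forall>n. 0 \<le> g n) \<and> (\<forall>n. g n \<le> (1 / Q k + 32 / Q (Suc k)) * real n) \<and> (\<forall>n. real n < Q k \<longrightarrow> g n = 0)"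
    for k
  proof -
    obtain q where q: "cf_den \<omega> k = int q"
      using cf_den_pos[OF \<omega>, of k] by (metis zero_le_imp_eq_int zero_le_one order.trans)
    have "\<exists>g. (\<forall>a b. g a + g b \<le> g (a + b)) \<and> (\<forall>n\<in>resonant \<omega> k. g (n - 1) + 1 \<le> g n) \<and>
      (\<forall>n. 0 \<le> g n) \<and> (\<forall>n. g n \<le> (1 / real q + 32 / Q (Suc k)) * real n) \<and> (\<forall>n<q. g n = 0)"
    proof (rule resonance_count_exists)
      show "q > 0" using cf_den_pos[OF \<omega>, of k] q by simp
      show "0 \<le> 32 / Q (Suc k)" using Q[of "Suc k"] by simp
      show "q \<le> n" if "n \<in> resonant \<omega> k" for n using resonant_ge[OF \<omega> that] q by simp
      show "2 \<le> 32 / Q (Suc k) * real (n - m)"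
        if "n \<in> resonant \<omega> k" "m = 0 \<or> m \<in> resonant \<omega> k" "m < n" "\<not> q dvd n - m" for m n
        unfolding Q_def by (rule resonant_gap[OF \<omega> that(1-3) q that(4)])
    qed
    then show ?thesis by (simp add: Q_def q)
  qed
  then obtain g :: "nat \<Rightarrow> nat \<Rightarrow> real" where
    g_super: "\<And>k a b. g k a + g k b \<le> g k (a + b)" and
    g_jump: "\<And>k n. n \<in> resonant \<omega> k \<Longrightarrow> g k (n - 1) + 1 \<le> g k n" and
    g_nonneg: "\<And>k n. 0 \<le> g k n" and
    g_le: "\<And>k n. g k n \<le> (1 / Q k + 32 / Q (Suc k)) * real n" and
    g_zero: "\<And>k n. real n < Q k \<Longrightarrow> g k n = 0"
    by metis
  define L where "L k = ln (4 * Q (Suc k))" for k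
  have L: "L k \<ge> 0" for k using Q[of "Suc k"] by (simp add: L_def)
  define K where "K n = real n * ln 4 + (\<Sum>k\<le>n. g k n * L k)" for n
  \<comment> \<open>terms with \<open>q\<^sub>k > n\<close> vanish, so sums for different \<open>n\<close> can be compared over one range\<close>
  have widen: "(\<Sum>k\<le>n. g k n * L k) = (\<Sum>k\<le>N. g k n * L k)" if "n \<le> N" for n N
  proof (rule sum.mono_neutral_left)
    show "\<forall>k\<in>{..N} - {..n}. g k n * L k = 0"
    proof
      fix k assume "k \<in> {..N} - {..n}"
      then have "real n < Q k" using Q_ge[of k] by auto
      then show "g k n * L k = 0" by (simp add: g_zero)
    qed
  qed (use that in auto)
  have super: "K a + K b \<le> K (a + b)" for a b
  proof -
    have "(\<Sum>k\<le>a. g k a * L k) + (\<Sum>k\<le>b. g k b * L k) = (\<Sum>k\<le>a+b. (g k a + g k b) * L k)"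
      by (simp add: widen[of a "a + b"] widen[of b "a + b"] distrib_right sum.distrib)
    also have "\<dots> \<le> (\<Sum>k\<le>a+b. g k (a + b) * L k)"
      by (intro sum_mono mult_right_mono g_super L)
    finally show ?thesis by (simp add: K_def algebra_simps)
  qed
  have nonneg: "0 \<le> K n" for n
    unfolding K_def by (intro add_nonneg_nonneg mult_nonneg_nonneg sum_nonneg g_nonneg L) auto
  have div: "exp (K (n - 1)) \<le> small_divisor \<omega> n * exp (K n)" if n: "n \<ge> 1" for n
  proof -
    have K_diff: "K n - K (n - 1) = ln 4 + (\<Sum>k\<le>n. (g k n - g k (n - 1)) * L k)"
    proof -
      have w: "(\<Sum>k\<le>n-1. g k (n - 1) * L k) = (\<Sum>k\<le>n. g k (n - 1) * L k)"
        by (rule widen) simp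
      show ?thesis
        unfolding K_def w using n by (simp add: sum_subtractf left_diff_distrib)
    qed
    have g_mono: "g k (n - 1) \<le> g k n" for k
      using g_super[of k "n - 1" 1] g_nonneg[of k 1] n by simp
    \<comment> \<open>\<open>x\<close> is the quantity whose logarithm is paid for: 4 if \<open>n\<close> is nowhere resonant, and
      \<open>4 q\<^bsub>j+1\<^esub>\<close> for the last level \<open>j\<close> of resonance otherwise\<close>
    have "\<exists>x. 1 / x \<le> small_divisor \<omega> n \<and> 0 < x \<and> ln x \<le> K n - K (n - 1)"
    proof (cases "n \<in> resonant \<omega> 0")
      case False
      have "0 \<le> (\<Sum>k\<le>n. (g k n - g k (n - 1)) * L k)"
        by (intro sum_nonneg mult_nonneg_nonneg L) (use g_mono in simp)
      then have "ln 4 \<le> K n - K (n - 1)" using K_diff by linarith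
      moreover have "1 / 4 \<le> small_divisor \<omega> n"
        using False n by (simp add: resonant_def cf_den_0)
      ultimately show ?thesis by (intro exI[of _ 4]) simp
    next
      case True
      define J where "J = {j. n \<in> resonant \<omega> j}"
      have J_le: "j \<le> n" if "j \<in> J" for j
      proof -
        have "cf_den \<omega> j \<le> int n" using that by (intro resonant_ge[OF \<omega>]) (simp add: J_def)
        then show ?thesis using cf_den_mono_aux[OF \<omega>, of j] by linarith
      qed
      then have finJ: "finite J" by (meson finite_nat_set_iff_bounded_le)
      define j where "j = Max J"
      have jJ: "j \<in> J" unfolding j_def by (rule Max_in[OF finJ]) (use True in \<open>auto simp: J_def\<close>)
      have "Suc j \<notin> J" using Max_ge[OF finJ, of "Suc j"] by (auto simp: j_def)
      then have "1 / (4 * Q (Suc j)) \<le> small_divisor \<omega> n"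
        using n by (simp add: J_def resonant_def Q_def)
      moreover have "L j \<le> K n - K (n - 1)"
      proof -
        have "1 * L j \<le> (g j n - g j (n - 1)) * L j"
          using g_jump[of n j] jJ by (intro mult_right_mono L) (simp add: J_def)
        also have "\<dots> \<le> (\<Sum>k\<le>n. (g k n - g k (n - 1)) * L k)"
          using J_le[OF jJ]
          by (intro member_le_sum[of j "{..n}" "\<lambda>k. (g k n - g k (n - 1)) * L k"] mult_nonneg_nonneg L)
             (use g_mono in auto)
        finally show ?thesis using K_diff by (simp add: add_increasing)
      qed
      ultimately show ?thesis using Q[of "Suc j"] by (intro exI[of _ "4 * Q (Suc j)"]) (simp add: L_def)
    qed
    then obtain x where x: "1 / x \<le> small_divisor \<omega> n" "0 < x" "ln x \<le> K n - K (n - 1)" by blast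
    have "exp (K (n - 1)) = 1 / x * exp (ln x + K (n - 1))" using x(2) by (simp add: exp_add)
    also have "\<dots> \<le> small_divisor \<omega> n * exp (K n)"
      using x by (intro mult_mono) (auto simp: small_divisor_def)
    finally show ?thesis .
  qed
  define u where "u k = (2 + ln (Q k)) / Q k" for k
  have u_nonneg: "0 \<le> u k" for k using Q[of k] by (simp add: u_def)
  have u_sum: "summable u" using summable_log_over_cf_den[OF \<omega>] by (simp add: u_def[abs_def] Q_def)
  define C where "C = ln 4 + (\<Sum>k. u k + 32 * u (Suc k))"
  have upper: "K n \<le> real n * ((\<Sum>k=0..cf_index \<omega> n. brjuno_term \<omega> k) + C)" if n: "n \<ge> 1" for n
  proof -
    let ?i = "cf_index \<omega> n"
    note i = cf_index_spec[OF \<omega> n]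
    have "?i \<le> n" using i(1) cf_den_mono_aux[OF \<omega>, of ?i] by linarith
    have "(\<Sum>k\<le>n. g k n * L k) = (\<Sum>k=0..?i. g k n * L k)"
    proof (rule sum.mono_neutral_right)
      show "\<forall>k\<in>{..n} - {0..?i}. g k n * L k = 0"
      proof
        fix k assume "k \<in> {..n} - {0..?i}"
        then have "cf_den \<omega> (Suc ?i) \<le> cf_den \<omega> k" by (intro cf_den_mono[OF \<omega>]) auto
        then have "real n < Q k" using i(2) unfolding Q_def by linarith
        then show "g k n * L k = 0" by (simp add: g_zero)
      qed
    qed (use \<open>?i \<le> n\<close> in auto)
    also have "\<dots> \<le> (\<Sum>k=0..?i. real n * (brjuno_term \<omega> k + (u k + 32 * u (Suc k))))"
    proof (rule sum_mono)
      fix k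
      have ln4: "ln 4 \<le> (2::real)"
        using ln_le_minus_one[of "2::real"] ln_realpow[of 2 2] by simp
      have "L k = ln 4 + ln (Q (Suc k))" using Q[of "Suc k"] by (simp add: L_def ln_mult)
      then have L_le: "L k \<le> 2 + ln (Q (Suc k))" using ln4 by simp
      have "g k n * L k \<le> ((1 / Q k + 32 / Q (Suc k)) * real n) * L k"
        by (intro mult_right_mono g_le L)
      also have "\<dots> \<le> ((1 / Q k + 32 / Q (Suc k)) * real n) * (2 + ln (Q (Suc k)))"
        using Q[of k] Q[of "Suc k"] L_le by (intro mult_left_mono) auto
      also have "\<dots> = real n * (brjuno_term \<omega> k + (2 / Q k + 32 * u (Suc k)))"
        unfolding brjuno_term_def u_def by (simp add: Q_def algebra_simps add_divide_distrib)
      also have "\<dots> \<le> real n * (brjuno_term \<omega> k + (u k + 32 * u (Suc k)))"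
        using Q[of k] by (intro mult_left_mono add_mono) (auto simp: u_def intro!: divide_right_mono)
      finally show "g k n * L k \<le> real n * (brjuno_term \<omega> k + (u k + 32 * u (Suc k)))" .
    qed
    also have "\<dots> = real n * ((\<Sum>k=0..?i. brjuno_term \<omega> k) + (\<Sum>k=0..?i. u k + 32 * u (Suc k)))"
      by (simp add: sum.distrib flip: sum_distrib_left)
    also have "\<dots> \<le> real n * ((\<Sum>k=0..?i. brjuno_term \<omega> k) + (\<Sum>k. u k + 32 * u (Suc k)))"
    proof (intro mult_left_mono add_left_mono sum_le_suminf)
      show "summable (\<lambda>k. u k + 32 * u (Suc k))"
        using u_sum by (intro summable_add summable_mult) (simp_all add: summable_Suc_iff)
    qed (auto intro!: add_nonneg_nonneg u_nonneg)
    finally show ?thesis by (simp add: K_def C_def algebra_simps)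
  qed
  show ?thesis using super nonneg div upper by blast
qed

section \<open>The majorant for the linearization\<close>

lemma sum_inverse_squares_le: "(\<Sum>j=1..n. 1 / real j ^ 2) \<le> 2"
proof -
  have *: "(\<Sum>j=1..Suc n. 1 / real j ^ 2) \<le> 2 - 1 / real (Suc n)" for n
  proof (induction n)
    case (Suc n)
    have "1 / real (Suc (Suc n)) ^ 2 \<le> 1 / (real (Suc n) * real (Suc (Suc n)))"
      by (intro divide_left_mono) (auto simp: power2_eq_square)
    also have "\<dots> = 1 / real (Suc n) - 1 / real (Suc (Suc n))"
      by (simp add: field_simps)
    finally show ?case using Suc by simp
  qed simp
  show ?thesis
  proof (cases n)
    case (Suc m)
    have "2 - 1 / real (Suc m) \<le> 2" by simp
    with * show ?thesis unfolding Suc by (rule order_trans)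
  qed simp
qed

text \<open>
  The sequence \<open>1 / n\<^sup>2\<close> reproduces itself under convolution up to a constant. Used as a weight, it
  replaces the estimate of an implicitly defined majorant series. The proof squares
  \<open>1 / (j (n - j)) = (1 / j + 1 / (n - j)) / n\<close>.
\<close>

lemma sum_inverse_squares_convolution:
  "(\<Sum>j=1..<n. 1 / (real j ^ 2 * real (n - j) ^ 2)) \<le> 8 / real n ^ 2"
proof (cases "n = 0")
  case False
  then have ivl: "{1..<n} = {1..n-1}" by auto
  have "1 / (real j ^ 2 * real (n - j) ^ 2) \<le>
      2 / real n ^ 2 * (1 / real j ^ 2 + 1 / real (n - j) ^ 2)" if j: "j \<in> {1..<n}" for j
  proof -
    define x y where "x = 1 / real j" and "y = 1 / real (n - j)"
    have "x * y = (x + y) / real n"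
      using j by (simp add: x_def y_def field_simps)
    then have "(x * y)\<^sup>2 = (x + y)\<^sup>2 / (real n)\<^sup>2"
      by (simp add: power_divide)
    also have "\<dots> \<le> (2 * (x\<^sup>2 + y\<^sup>2)) / (real n)\<^sup>2"
      using sum_squares_bound[of x y] by (intro divide_right_mono) (auto simp: power2_sum)
    finally show ?thesis by (simp add: x_def y_def power_mult_distrib power_divide)
  qed
  then have "(\<Sum>j=1..<n. 1 / (real j ^ 2 * real (n - j) ^ 2)) \<le>
      (\<Sum>j=1..<n. 2 / real n ^ 2 * (1 / real j ^ 2 + 1 / real (n - j) ^ 2))"
    by (rule sum_mono)
  also have "\<dots> = 2 / real n ^ 2 * ((\<Sum>j=1..<n. 1 / real j ^ 2) + (\<Sum>j=1..<n. 1 / real (n - j) ^ 2))"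
    by (simp only: sum.distrib sum_distrib_left[symmetric])
  also have "(\<Sum>j=1..<n. 1 / real (n - j) ^ 2) = (\<Sum>j=1..<n. 1 / real j ^ 2)"
    by (rule sum.reindex_bij_witness[of _ "\<lambda>j. n - j" "\<lambda>j. n - j"]) auto
  also have "2 / (real n)\<^sup>2 * ((\<Sum>j=1..<n. 1 / (real j)\<^sup>2) + (\<Sum>j=1..<n. 1 / (real j)\<^sup>2))
      \<le> 2 / (real n)\<^sup>2 * (2 + 2)"
    unfolding ivl by (intro mult_left_mono add_mono sum_inverse_squares_le) auto
  finally show ?thesis by simp
qed simp

text \<open>
  Raising \<open>G\<close> to the power \<open>m + 1\<close> multiplies \<open>V\<close>-values whose indices sum to \<open>n - m - 1\<close>, because
  each factor of order \<open>j\<close> carries index \<open>j - 1\<close>. This shift is what later leaves room for the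
  weight of the outer coefficient and for the small divisor.
\<close>

lemma fps_power_coeff_bound:
  fixes G :: "complex fps" and V :: "nat \<Rightarrow> real"
  assumes G0: "fps_nth G 0 = 0"
    and V: "\<And>a. 0 \<le> V a" "\<And>a b. V a * V b \<le> V (a + b)"
    and d: "0 \<le> d" and A: "0 \<le> A"
    and G: "\<And>j. 1 \<le> j \<Longrightarrow> norm (fps_nth G j) \<le> d * A ^ j / real j ^ 2 * V (j - 1)"
  shows "Suc m \<le> n \<Longrightarrow>
    norm (fps_nth (G ^ Suc m) n) \<le> d ^ Suc m * 8 ^ m * A ^ n / real n ^ 2 * V (n - Suc m)"
proof (induction m arbitrary: n)
  case 0
  then show ?case using G[of n] by simp
next
  case (Suc m)
  define B where "B = d ^ Suc (Suc m) * 8 ^ m * A ^ n * V (n - Suc (Suc m))"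
  have B: "B \<ge> 0" using d A V by (simp add: B_def)
  have summand: "norm (fps_nth G j * fps_nth (G ^ Suc m) (n - j)) \<le> B * (1 / (real j ^ 2 * real (n - j) ^ 2))"
    if j: "j \<in> {1..<n}" for j
  proof (cases "Suc m \<le> n - j")
    case True
    have "norm (fps_nth G j * fps_nth (G ^ Suc m) (n - j)) \<le>
       (d * A ^ j / real j ^ 2 * V (j - 1)) *
       (d ^ Suc m * 8 ^ m * A ^ (n - j) / real (n - j) ^ 2 * V (n - j - Suc m))"
      unfolding norm_mult using G[of j] j Suc.IH[OF True] d A V
      by (intro mult_mono) auto
    also have "\<dots> = d ^ Suc (Suc m) * 8 ^ m * (A ^ j * A ^ (n - j)) / (real j ^ 2 * real (n - j) ^ 2) *
        (V (j - 1) * V (n - j - Suc m))"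
      by simp
    also have "A ^ j * A ^ (n - j) = A ^ n" using j by (simp flip: power_add)
    also have "d ^ Suc (Suc m) * 8 ^ m * A ^ n / (real j ^ 2 * real (n - j) ^ 2) * (V (j - 1) * V (n - j - Suc m))
      \<le> d ^ Suc (Suc m) * 8 ^ m * A ^ n / (real j ^ 2 * real (n - j) ^ 2) * V ((j - 1) + (n - j - Suc m))"
      using d A V by (intro mult_left_mono) auto
    also have "(j - 1) + (n - j - Suc m) = n - Suc (Suc m)" using j True by auto
    finally show ?thesis by (simp add: B_def)
  next
    case False
    then have "fps_nth (G ^ Suc m) (n - j) = 0"
      using G0 by (intro startsby_zero_power_prefix[rule_format]) auto
    then show ?thesis using B by simp
  qed
  have "fps_nth (G ^ Suc (Suc m)) n = (\<Sum>j=0..n. fps_nth G j * fps_nth (G ^ Suc m) (n - j))"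
    by (simp only: power_Suc[of G "Suc m"] fps_mult_nth)
  also have "\<dots> = (\<Sum>j=1..<n. fps_nth G j * fps_nth (G ^ Suc m) (n - j))"
  proof (rule sum.mono_neutral_right)
    show "\<forall>j\<in>{0..n} - {1..<n}. fps_nth G j * fps_nth (G ^ Suc m) (n - j) = 0"
    proof
      fix j assume "j \<in> {0..n} - {1..<n}"
      then have "j = 0 \<or> j = n" by auto
      then show "fps_nth G j * fps_nth (G ^ Suc m) (n - j) = 0" using G0 by auto
    qed
  qed auto
  finally have "norm (fps_nth (G ^ Suc (Suc m)) n) \<le>
      (\<Sum>j=1..<n. B * (1 / (real j ^ 2 * real (n - j) ^ 2)))"
    by (simp only:) (rule sum_norm_le, rule summand)
  also have "\<dots> = B * (\<Sum>j=1..<n. 1 / (real j ^ 2 * real (n - j) ^ 2))"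
    by (simp only: sum_distrib_left)
  also have "\<dots> \<le> B * (8 / real n ^ 2)"
    by (intro mult_left_mono sum_inverse_squares_convolution B)
  finally show ?case by (simp add: B_def mult_ac)
qed

lemma sum_powers_from_2_le:
  fixes x :: real
  assumes "0 \<le> x" "x \<le> 1/2"
  shows "(\<Sum>i=2..n. x ^ i) \<le> 2 * x\<^sup>2"
proof (cases "n \<ge> 2")
  case True
  have "(\<Sum>i=0..n-2. x ^ i) \<le> (\<Sum>i. x ^ i)"
    using assms by (intro sum_le_suminf summable_geometric) auto
  also have "(\<Sum>i. x ^ i) = 1 / (1 - x)" using assms by (intro suminf_geometric) auto
  also have "\<dots> \<le> 2" using assms by (simp add: field_simps)
  finally have "x\<^sup>2 * (\<Sum>i=0..n-2. x ^ i) \<le> x\<^sup>2 * 2" by (intro mult_left_mono) auto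
  moreover have "(\<Sum>i=2..n. x ^ i) = x\<^sup>2 * (\<Sum>i=0..n-2. x ^ i)"
    unfolding sum_distrib_left power_add[symmetric]
    by (rule sum.reindex_bij_witness[of _ "\<lambda>i. i + 2" "\<lambda>i. i - 2"])
       (use True in \<open>auto simp flip: power_Suc simp: Suc_diff_Suc numeral_2_eq_2\<close>)
  ultimately show ?thesis by simp
qed auto

text \<open>
  The induction runs with \<open>V a = exp (K a) * N (a + 1)\<close>, which is supermultiplicative precisely
  because \<open>K\<close> is superadditive and \<open>N a * N b \<le> N (a + b - 1)\<close>. In the recursion for \<open>h\<^sub>n\<close> the
  term of index \<open>i\<close> contains \<open>N i * V (n - i)\<close>, which is at most \<open>N n * exp (K (n - 2))\<close> as
  \<open>i \<ge> 2\<close>, and the divisor \<open>\<bar>l\<^sup>n - l\<bar> = \<bar>l\<^bsup>n-1\<^esup> - 1\<bar>\<close> turns \<open>exp (K (n - 2))\<close> into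
  \<open>exp (K (n - 1))\<close>. The remaining sum over \<open>i\<close> is geometric of ratio \<open>8 R d\<close> and starts
  quadratically, so it is at most \<open>d\<close> for small \<open>d\<close>.
\<close>

lemma linearization_majorant:
  fixes F H :: "complex fps" and N K :: "nat \<Rightarrow> real"
  assumes lin: "is_linearization F H" and F0: "fps_nth F 0 = 0"
    and l: "fps_nth F 1 = l" "norm l = 1" and nres: "\<And>n. 2 \<le> n \<Longrightarrow> l ^ n \<noteq> l"
    and N: "\<And>n. 1 \<le> n \<Longrightarrow> 0 < N n"
      "\<And>m n. 1 \<le> m \<Longrightarrow> 1 \<le> n \<Longrightarrow> N n * N m \<le> N (m + n - 1)"
    and K: "\<And>a b. K a + K b \<le> K (a + b)" "\<And>n. 0 \<le> K n"
    and div: "\<And>n. 1 \<le> n \<Longrightarrow> exp (K (n - 1)) \<le> norm (l ^ n - 1) * exp (K n)"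
    and c: "0 < C" "0 < R" and F: "\<And>n. 1 \<le> n \<Longrightarrow> norm (fps_nth F n) \<le> C * R ^ n * N n"
  shows "\<exists>d>0. \<exists>A>0. \<forall>n\<ge>1. norm (fps_nth H n) \<le> d * A ^ n * exp (K n) * N n"
proof -
  have K_mono: "K a \<le> K b" if "a \<le> b" for a b
    using K(1)[of a "b - a"] K(2)[of "b - a"] that by simp
  define V where "V a = exp (K a) * N (Suc a)" for a
  have V_pos: "0 < V a" for a using N(1)[of "Suc a"] by (simp add: V_def)
  have V_mult: "V a * V b \<le> V (a + b)" for a b
  proof -
    have "V a * V b = exp (K a + K b) * (N (Suc a) * N (Suc b))"
      by (simp add: V_def exp_add mult_ac)
    also have "\<dots> \<le> exp (K (a + b)) * N (Suc (a + b))"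
      using K(1)[of a b] N(1)[of "Suc a"] N(1)[of "Suc b"] N(2)[of "Suc b" "Suc a"]
      by (intro mult_mono) (auto simp: add.commute)
    finally show ?thesis by (simp add: V_def)
  qed
  \<comment> \<open>the first bound keeps the ratio of the geometric sum at most 1/2, the second makes that sum
    at most \<open>d\<close>\<close>
  define d where "d = min (1 / (16 * R)) (1 / (16 * C * R\<^sup>2))"
  have d: "d > 0" "d \<le> 1 / (16 * R)" "d \<le> 1 / (16 * C * R\<^sup>2)" using c by (auto simp: d_def)
  \<comment> \<open>makes the bound an equality at \<open>n = 1\<close>, where the coefficient is 1\<close>
  define A where "A = 1 / (d * V 0)"
  have A: "A > 0" using d V_pos by (simp add: A_def)
  define x where "x = 8 * R * d"
  have x: "0 \<le> x" "x \<le> 1/2" using d c by (auto simp: x_def field_simps)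
  have geometric: "C / 8 * (\<Sum>i=2..n. x ^ i) \<le> d" for n
  proof -
    have "C / 8 * (\<Sum>i=2..n. x ^ i) \<le> C / 8 * (2 * x\<^sup>2)"
      using c by (intro mult_left_mono sum_powers_from_2_le[OF x]) auto
    also have "\<dots> = (16 * C * R\<^sup>2 * d) * d" by (simp add: x_def power2_eq_square)
    also have "\<dots> \<le> 1 * d"
      using d c by (intro mult_right_mono) (auto simp: field_simps)
    finally show ?thesis by simp
  qed
  have "norm (fps_nth H n) \<le> d * A ^ n / real n ^ 2 * V (n - 1)" if "n \<ge> 1" for n
    using that
  proof (induction n rule: less_induct)
    case (less n)
    show ?case
    proof (cases "n = 1")
      case True
      then show ?thesis using lin d V_pos[of 0] by (simp add: is_linearization_def A_def)
    next
      case False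
      then have n: "n \<ge> 2" using less.prems by simp
      define G where "G = fps_cutoff n H"
      have power: "norm (fps_nth (G ^ i) n) \<le> d ^ i * 8 ^ (i - 1) * A ^ n / real n ^ 2 * V (n - i)"
        if i: "2 \<le> i" "i \<le> n" for i
      proof -
        have "norm (fps_nth (G ^ Suc (i - 1)) n) \<le>
            d ^ Suc (i - 1) * 8 ^ (i - 1) * A ^ n / real n ^ 2 * V (n - Suc (i - 1))"
        proof (rule fps_power_coeff_bound)
          show "fps_nth G 0 = 0" using lin by (simp add: G_def is_linearization_def)
          show "norm (fps_nth G j) \<le> d * A ^ j / (real j)\<^sup>2 * V (j - 1)" if "1 \<le> j" for j
            using less.IH[of j] that d A V_pos[of "j - 1"] by (auto simp: G_def)
        qed (use i d A V_pos V_mult in \<open>auto intro: less_imp_le\<close>)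
        then show ?thesis using i by simp
      qed
      have summand: "norm (fps_nth F i * fps_nth (G ^ i) n) \<le>
          A ^ n / real n ^ 2 * (N n * exp (K (n - 2))) * (C / 8 * x ^ i)" if i: "i \<in> {2..n}" for i
      proof -
        have "norm (fps_nth F i * fps_nth (G ^ i) n) \<le>
           (C * R ^ i * N i) * (d ^ i * 8 ^ (i - 1) * A ^ n / real n ^ 2 * V (n - i))"
          unfolding norm_mult using i F[of i] power[of i] c N(1)[of i] by (intro mult_mono) auto
        also have "\<dots> = A ^ n / real n ^ 2 * (N i * V (n - i)) * (C / 8 * x ^ i)"
        proof -
          obtain k where "i = Suc k" using i by (cases i) auto
          then show ?thesis by (simp add: x_def power_mult_distrib)
        qed
        also have "\<dots> \<le> A ^ n / real n ^ 2 * (N n * exp (K (n - 2))) * (C / 8 * x ^ i)"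
        proof (intro mult_right_mono mult_left_mono)
          have "N i * V (n - i) = (N (Suc (n - i)) * N i) * exp (K (n - i))"
            by (simp add: V_def)
          also have "\<dots> \<le> N n * exp (K (n - 2))"
            using i N(2)[of i "Suc (n - i)"] N(1)[of n] K_mono[of "n - i" "n - 2"]
            by (intro mult_mono) auto
          finally show "N i * V (n - i) \<le> N n * exp (K (n - 2))" .
        qed (use A c x in auto)
        finally show ?thesis .
      qed
      have "norm (\<Sum>i=2..n. fps_nth F i * fps_nth (G ^ i) n) \<le>
          (\<Sum>i=2..n. A ^ n / real n ^ 2 * (N n * exp (K (n - 2))) * (C / 8 * x ^ i))"
        by (rule sum_norm_le) (rule summand)
      also have "\<dots> = A ^ n / real n ^ 2 * (N n * exp (K (n - 2))) * (C / 8 * (\<Sum>i=2..n. x ^ i))"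
        by (simp add: sum_distrib_left)
      also have "\<dots> \<le> A ^ n / real n ^ 2 * (N n * exp (K (n - 2))) * d"
        using A N(1)[of n] n by (intro mult_left_mono geometric) auto
      also have "\<dots> \<le> A ^ n / real n ^ 2 * (N n * (norm (l ^ (n - 1) - 1) * exp (K (n - 1)))) * d"
        using A N(1)[of n] n d div[of "n - 1"]
        by (intro mult_right_mono mult_left_mono) (auto simp: numeral_2_eq_2)
      also have "\<dots> = norm (l ^ (n - 1) - 1) * (d * A ^ n / real n ^ 2 * V (n - 1))"
        using n by (simp add: V_def)
      finally have main: "norm (\<Sum>i=2..n. fps_nth F i * fps_nth (G ^ i) n) \<le>
          norm (l ^ (n - 1) - 1) * (d * A ^ n / real n ^ 2 * V (n - 1))" .
      have "l ^ n - l = l * (l ^ (n - 1) - 1)"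
        using n by (simp add: right_diff_distrib flip: power_Suc)
      then have den: "norm (l ^ n - l) = norm (l ^ (n - 1) - 1)" using l(2) by (simp add: norm_mult)
      have pos: "norm (l ^ n - l) > 0" using nres[OF n] by simp
      have "fps_nth H n = (\<Sum>i=2..n. fps_nth F i * fps_nth (G ^ i) n) / (l ^ n - l)"
        using is_linearization_iff[of F H] F0 nres lin n unfolding l(1) G_def by blast
      then have "norm (fps_nth H n) = norm (\<Sum>i=2..n. fps_nth F i * fps_nth (G ^ i) n) / norm (l ^ n - l)"
        by (simp add: norm_divide)
      also have "\<dots> \<le> d * A ^ n / real n ^ 2 * V (n - 1)"
        using main pos den by (simp add: pos_divide_le_eq mult.commute)
      finally show ?thesis .
    qed
  qed
  moreover have "d * A ^ n / real n ^ 2 * V (n - 1) \<le> d * A ^ n * exp (K n) * N n" if "n \<ge> 1" for n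
  proof -
    have "d * A ^ n / real n ^ 2 \<le> d * A ^ n / 1"
      using that d A by (intro divide_left_mono) auto
    moreover have "V (n - 1) \<le> exp (K n) * N n"
      using that K_mono[of "n - 1" n] N(1)[of n] by (simp add: V_def)
    ultimately have "d * A ^ n / real n ^ 2 * V (n - 1) \<le> d * A ^ n / 1 * (exp (K n) * N n)"
      using d A V_pos[of "n - 1"] by (intro mult_mono) auto
    then show ?thesis by (simp add: mult_ac)
  qed
  ultimately show ?thesis
    using d A by (meson order_trans)
qed

section \<open>Comparison of weights\<close>

lemma weighted_seriesI_eventually:
  assumes M: "\<And>n. 1 \<le> n \<Longrightarrow> 0 < M n" and H0: "fps_nth H 0 = 0" and c: "0 < a" "0 < s"
    and ev: "\<forall>\<^sub>F n in sequentially. norm (fps_nth H n) \<le> a * s ^ n * M n"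
  shows "H \<in> weighted_series M"
proof -
  define r where "r n = norm (fps_nth H n) / (s ^ n * M n)" for n
  obtain n0 where n0: "\<And>n. n \<ge> n0 \<Longrightarrow> norm (fps_nth H n) \<le> a * s ^ n * M n"
    using ev by (auto simp: eventually_sequentially)
  have r: "0 \<le> r n" if "n \<ge> 1" for n using c M[OF that] by (simp add: r_def)
  define b where "b = a + (\<Sum>n\<in>{1..n0}. r n)"
  have b: "a \<le> b" using sum_nonneg[of "{1..n0}" r] r by (simp add: b_def)
  have "norm (fps_nth H n) \<le> b * s ^ n * M n" if n: "n \<ge> 1" for n
  proof (cases "n \<ge> n0")
    case True
    have "a * s ^ n * M n \<le> b * s ^ n * M n"
      using b c M[OF n] by (intro mult_right_mono) auto
    then show ?thesis using n0[OF True] by linarith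
  next
    case False
    have "r n \<le> (\<Sum>n\<in>{1..n0}. r n)" using False n r by (intro member_le_sum) auto
    then have "r n \<le> b" using c by (simp add: b_def)
    then have "r n * (s ^ n * M n) \<le> b * (s ^ n * M n)"
      using c M[OF n] by (intro mult_right_mono) auto
    then show ?thesis using c M[OF n] by (simp add: r_def)
  qed
  then have "\<exists>a>0. \<exists>s>0. \<forall>n\<ge>1. norm (fps_nth H n) \<le> a * s ^ n * M n"
    using b c by (intro exI[of _ b] exI[of _ s]) auto
  then show ?thesis using H0 by (simp add: weighted_series_def)
qed

text \<open>
  A finite limit superior says that \<open>exp (n B\<^sub>n) N\<^sub>n\<close> is eventually at most
  \<open>exp (n C) M\<^sub>n\<close> for some constant \<open>C\<close>.
\<close>

lemma weighted_seriesI_growth: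
  assumes M: "\<And>n. 1 \<le> n \<Longrightarrow> 0 < M n" and N: "\<And>n. 1 \<le> n \<Longrightarrow> 0 < N n"
    and H0: "fps_nth H 0 = 0" and c: "0 < a" "0 < s"
    and H: "\<And>n. 1 \<le> n \<Longrightarrow> norm (fps_nth H n) \<le> a * s ^ n * exp (real n * B n) * N n"
    and lim: "limsup (\<lambda>n. ereal (B n - 1 / real n * ln (M n / N n))) < \<infinity>"
  shows "H \<in> weighted_series M"
proof -
  obtain C where "limsup (\<lambda>n. ereal (B n - 1 / real n * ln (M n / N n))) < ereal C"
    using less_PInf_Ex_of_nat lim by force
  then have "\<forall>\<^sub>F n in sequentially. ereal (B n - 1 / real n * ln (M n / N n)) < ereal C"
    by (rule Limsup_lessD)
  then have "\<forall>\<^sub>F n in sequentially. norm (fps_nth H n) \<le> a * (s * exp C) ^ n * M n"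
    using eventually_ge_at_top[of 1]
  proof eventually_elim
    case (elim n)
    then have "real n * (B n - 1 / real n * ln (M n / N n)) \<le> real n * C"
      by (intro mult_left_mono) auto
    then have "real n * B n \<le> real n * C + ln (M n / N n)"
      using elim by (simp add: algebra_simps)
    then have "exp (real n * B n) \<le> exp C ^ n * (M n / N n)"
      using elim M[of n] N[of n] by (simp add: exp_add flip: exp_of_nat_mult)
         (metis divide_pos_pos exp_add exp_ln exp_le_cancel_iff times_divide_eq_right)
    then have "exp (real n * B n) * N n \<le> exp C ^ n * M n"
      using elim N[of n] by (simp add: field_simps)
    then have "a * s ^ n * (exp (real n * B n) * N n) \<le> a * s ^ n * (exp C ^ n * M n)"
      using c by (intro mult_left_mono) auto
    then show ?case using H[of n] elim by (simp add: power_mult_distrib mult_ac)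
  qed
  then show ?thesis
    using c by (intro weighted_seriesI_eventually[OF M H0]) auto
qed

lemma convergent_series_imp_weighted:
  assumes "F \<in> convergent_series"
  shows "F \<in> weighted_series (\<lambda>_. 1)"
proof -
  obtain R where R: "0 < R" "ereal R < fps_conv_radius F"
    using assms ereal_dense2[of 0 "fps_conv_radius F"] by (auto simp: convergent_series_def zero_ereal_def)
  then have "summable (\<lambda>n. fps_nth F n * of_real R ^ n)"
    unfolding fps_conv_radius_def by (intro summable_in_conv_radius) simp
  then have "Bseq (\<lambda>n. fps_nth F n * of_real R ^ n)"
    by (intro convergent_imp_Bseq) (auto simp: convergent_def dest: summable_LIMSEQ_zero)
  then obtain b where b: "b > 0" "\<And>n. norm (fps_nth F n * of_real R ^ n) \<le> b"
    by (auto elim: BseqE)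
  have "norm (fps_nth F n) \<le> b * (1 / R) ^ n * 1" for n
    using b(2)[of n] R(1) by (simp add: norm_mult norm_power field_simps)
  then have "\<exists>a>0. \<exists>s>0. \<forall>n\<ge>1. norm (fps_nth F n) \<le> a * s ^ n * 1"
    using b R by (intro exI[of _ b] exI[of _ "1 / R"] conjI allI impI) auto
  then show ?thesis using assms by (simp add: weighted_series_def convergent_series_def)
qed

lemma weight_seq_one: "weight_seq (\<lambda>_. 1)"
  unfolding weight_seq_def by (auto simp: mono_on_def intro!: exI[of _ 1])

text \<open>
  The common source of all three parts of the theorem: passing from \<open>F\<close> to its linearization costs
  \<open>n\<close> times the partial Brjuno sum up to \<open>k(n)\<close> in the exponent, apart from a geometric factor.
\<close>

lemma linearization_coeff_bound:
  assumes \<omega>: "\<omega> \<notin> \<rat>" and F0: "fps_nth F 0 = 0"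
    and F1: "fps_nth F 1 = exp (2 * of_real pi * \<i> * of_real \<omega>)"
    and N: "weight_seq N" and F: "F \<in> weighted_series N"
  shows "\<exists>c1>0. \<exists>c2>0. \<forall>n\<ge>1. norm (fps_nth (linearization F) n) \<le>
    c1 * c2 ^ n * exp (real n * (\<Sum>k=0..cf_index \<omega> n. brjuno_term \<omega> k)) * N n"
proof -
  let ?l = "exp (2 * of_real pi * \<i> * of_real \<omega>) :: complex"
  obtain K C where K: "\<And>a b. K a + K b \<le> K (a + b)" "\<And>n. 0 \<le> K n"
    and div: "\<And>n. 1 \<le> n \<Longrightarrow> exp (K (n - 1)) \<le> small_divisor \<omega> n * exp (K n)"
    and K_le: "\<And>n. 1 \<le> n \<Longrightarrow> K n \<le> real n * ((\<Sum>k=0..cf_index \<omega> n. brjuno_term \<omega> k) + C)"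
    using superadditive_small_divisor_bound[OF \<omega>] by blast
  obtain c1 c2 where c: "0 < c1" "0 < c2" and Fc: "\<And>n. 1 \<le> n \<Longrightarrow> norm (fps_nth F n) \<le> c1 * c2 ^ n * N n"
    using F unfolding weighted_series_def by blast
  have nres: "?l ^ n \<noteq> ?l" if "2 \<le> n" for n
    by (rule multiplier_power_neq[OF \<omega> that])
  have "is_linearization F (linearization F)"
    by (rule is_linearization_linearization[OF F0]) (unfold F1, rule nres)
  then have "\<exists>d>0. \<exists>A>0. \<forall>n\<ge>1. norm (fps_nth (linearization F) n) \<le> d * A ^ n * exp (K n) * N n"
  proof (rule linearization_majorant[where l = ?l and C = c1 and R = c2])
    show "0 < N n" if "1 \<le> n" for n using N that by (simp add: weight_seq_def)
    show "N n * N m \<le> N (m + n - 1)" if "1 \<le> m" "1 \<le> n" for m n using N that by (simp add: weight_seq_def)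
    show "exp (K (n - 1)) \<le> norm (?l ^ n - 1) * exp (K n)" if "1 \<le> n" for n
      using div[OF that] by (simp add: small_divisor_def)
  qed (use F0 F1 K c Fc nres in auto)
  then obtain d A where dA: "d > 0" "A > 0"
    and H: "\<And>n. 1 \<le> n \<Longrightarrow> norm (fps_nth (linearization F) n) \<le> d * A ^ n * exp (K n) * N n"
    by blast
  have "norm (fps_nth (linearization F) n) \<le>
    d * (A * exp C) ^ n * exp (real n * (\<Sum>k=0..cf_index \<omega> n. brjuno_term \<omega> k)) * N n" if n: "n \<ge> 1" for n
  proof -
    let ?B = "\<Sum>k=0..cf_index \<omega> n. brjuno_term \<omega> k"
    have "exp (K n) \<le> exp (real n * (?B + C))" using K_le[OF n] by simp
    also have "\<dots> = exp C ^ n * exp (real n * ?B)"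
      by (simp add: distrib_left exp_add mult.commute flip: exp_of_nat_mult)
    finally have "d * A ^ n * exp (K n) * N n \<le> d * A ^ n * (exp C ^ n * exp (real n * ?B)) * N n"
      using dA N n by (intro mult_right_mono mult_left_mono) (auto simp: weight_seq_def intro: less_imp_le)
    then show ?thesis using H[OF n] by (simp add: power_mult_distrib mult_ac)
  qed
  then show ?thesis
    using dA by (intro exI[of _ d] exI[of _ "A * exp C"] conjI allI impI) auto
qed

theorem theorem2p3:
  fixes \<omega> :: real and lam :: complex and M :: "nat \<Rightarrow> real" and F H :: "complex fps"
  assumes "\<omega> \<notin> \<rat>"
    and "lam = exp (2 * of_real pi * \<i> * of_real \<omega>)"
    and "weight_seq M"
    and "fps_nth F 0 = 0" and "fps_nth F 1 = lam"
    and "H = linearization F"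
  shows "(F \<in> weighted_series M \<and> brjuno \<omega> \<longrightarrow> H \<in> weighted_series M) \<and>
    (F \<in> convergent_series \<and>
      limsup (\<lambda>n. ereal ((\<Sum>k=0..cf_index \<omega> n. brjuno_term \<omega> k) - 1 / real n * ln (M n))) < \<infinity>
      \<longrightarrow> H \<in> weighted_series M) \<and>
    (\<forall>N :: nat \<Rightarrow> real. weight_seq N \<and> (\<forall>\<^sub>F n in sequentially. M n \<ge> N n) \<and>
      F \<in> weighted_series N \<and>
      limsup (\<lambda>n. ereal ((\<Sum>k=0..cf_index \<omega> n. brjuno_term \<omega> k) - 1 / real n * ln (M n / N n))) < \<infinity>
      \<longrightarrow> H \<in> weighted_series M)"
proof -
  let ?B = "\<lambda>n. \<Sum>k=0..cf_index \<omega> n. brjuno_term \<omega> k"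
  have H0: "fps_nth H 0 = 0"
    using is_linearization_linearization[OF assms(4)] multiplier_power_neq[OF assms(1)] assms(2,5,6)
    by (auto simp: is_linearization_def)
  have main: "H \<in> weighted_series M"
    if N: "weight_seq N" "F \<in> weighted_series N"
      and lim: "limsup (\<lambda>n. ereal (?B n - 1 / real n * ln (M n / N n))) < \<infinity>" for N
  proof -
    obtain c1 c2 where "0 < c1" "0 < c2"
      "\<And>n. 1 \<le> n \<Longrightarrow> norm (fps_nth H n) \<le> c1 * c2 ^ n * exp (real n * ?B n) * N n"
      using linearization_coeff_bound[OF assms(1,4) _ N] assms(2,5,6) by blast
    then show ?thesis
      using assms(3) N(1) H0 lim
      by (intro weighted_seriesI_growth[where N = N and B = ?B and a = c1 and s = c2]) (auto simp: weight_seq_def)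
  qed
  show ?thesis
  proof (intro conjI impI allI; elim conjE)
    assume F: "F \<in> weighted_series M" and br: "brjuno \<omega>"
    have "limsup (\<lambda>n. ereal (?B n - 1 / real n * ln (M n / M n))) \<le> ereal (\<Sum>k. brjuno_term \<omega> k)"
    proof (intro Limsup_bounded eventually_sequentiallyI[of 1])
      fix n :: nat assume "1 \<le> n"
      then have "M n \<noteq> 0" using assms(3) by (fastforce simp: weight_seq_def)
      moreover have "?B n \<le> (\<Sum>k. brjuno_term \<omega> k)"
        using br by (intro sum_le_suminf) (auto simp: brjuno_def brjuno_term_nonneg)
      ultimately show "ereal (?B n - 1 / real n * ln (M n / M n)) \<le> ereal (\<Sum>k. brjuno_term \<omega> k)"
        by simp
    qed
    also have "\<dots> < \<infinity>" by simp
    finally show "H \<in> weighted_series M" using assms(3) F by (intro main)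
  next
    assume "F \<in> convergent_series" "limsup (\<lambda>n. ereal (?B n - 1 / real n * ln (M n))) < \<infinity>"
    then show "H \<in> weighted_series M"
      by (intro main[of "\<lambda>_. 1"] weight_seq_one convergent_series_imp_weighted) auto
  next
    fix N :: "nat \<Rightarrow> real"
    assume "weight_seq N" "F \<in> weighted_series N"
      "limsup (\<lambda>n. ereal (?B n - 1 / real n * ln (M n / N n))) < \<infinity>"
    then show "H \<in> weighted_series M" by (rule main)
  qed
qed

end
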